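(* Let $K$ be a proper cone of $\mathbb{R}^n$ and let $A\in\pi(K)$. (i) For any faces $F,G$ of $K$: (a) $\operatorname{sp}_A(F)=\operatorname{sp}_A(\widehat F)$, where $\widehat F$ is the smallest $A$-invariant face of $K$ including $F$. (b) If $F\subseteq G$, then $\operatorname{sp}_A(F)\preceq\operatorname{sp}_A(G)$. (c) $\operatorname{sp}_A(F\vee G)=\max\{\operatorname{sp}_A(F),\operatorname{sp}_A(G)\}$, where the maximum is taken in the sense of lexicographic ordering. (ii) For any vectors $x,y\in K$: (a) $\operatorname{sp}_A(x)=\operatorname{sp}_A((I+A)^{n-1}x)$. (b) If $x\in\Phi(y)$, then $\operatorname{sp}_A(x)\preceq\operatorname{sp}_A(y)$. (c) $\operatorname{sp}_A(x+y)=\max\{\operatorname{sp}_A(x),\operatorname{sp}_A(y)\}$, where the maximum is taken in the sense of lexicographic ordering.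
   Context: A proper cone of $\mathbb{R}^n$ is a closed convex cone that is pointed ($K\cap(-K)=\{0\}$) and has nonempty interior. $\pi(K)$ is the set of real $n\times n$ matrices $A$ with $AK\subseteq K$. A face of $K$ is a convex subcone $F\subseteq K$ such that $x,y\in K$, $x+y\in F$ imply $x,y\in F$; it is $A$-invariant if $AF\subseteq F$. $\Phi(S)$ is the smallest face of $K$ including $S$, $\Phi(y)=\Phi(\{y\})$, and $F\vee G=\Phi(F\cup G)$. Spectral pairs: a generalized eigenvector of $A$ corresponding to $\lambda\in\mathbb{C}$ is a nonzero $x\in\mathbb{C}^n$ with $(\lambda I-A)^kx=0$ for some positive integer $k$; the least such $k$ is its order. A nonzero $x\in\mathbb{C}^n$ is written uniquely as $x=x_1+\dots+x_m$ with $x_i$ generalized eigenvectors of $A$ corresponding to distinct eigenvalues $\lambda_1,\dots,\lambda_m$. Then $\rho_x(A)=\max_i|\lambda_i|$, $\operatorname{ord}_A(x)$ is the maximum of the orders of those $x_i$ with $|\lambda_i|=\rho_x(A)$, and $\operatorname{sp}_A(x)=(\rho_x(A),\operatorname{ord}_A(x))$; also $\operatorname{sp}_A(0)=(0,0)$. For a face $F$ of $K$, $\operatorname{sp}_A(x)$ has the same value for all $x\in\operatorname{relint}F$, and this value is denoted $\operatorname{sp}_A(F)$. The lexicographic ordering on pairs of reals is: $(\xi_1,\xi_2)\preceq(\eta_1,\eta_2)$ iff $\xi_1<\eta_1$, or $\xi_1=\eta_1$ and $\xi_2\le\eta_2$. *)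

theory Defs
  imports "HOL-Analysis.Analysis"
begin

subsection \<open>Proper cones, cone-preserving matrices and faces\<close>

definition proper_cone :: "'a::euclidean_space set \<Rightarrow> bool" where
  "proper_cone K \<longleftrightarrow>
     closed K \<and> convex_cone K \<and> K \<inter> uminus ` K = {0} \<and> interior K \<noteq> {}"

definition cone_preserving :: "(real ^ 'n) set \<Rightarrow> (real ^ 'n ^ 'n) set" where
  "cone_preserving K = {A. (*v) A ` K \<subseteq> K}"

text \<open>Since \<^const>\<open>convex_cone\<close> includes nonemptiness, every face contains 0
  (the empty set, which satisfies \<^const>\<open>face_of\<close>, is not a face here).\<close>

definition cone_face :: "'a::real_vector set \<Rightarrow> 'a set \<Rightarrow> bool" where
  "cone_face K F \<longleftrightarrow>
     convex_cone F \<and> F \<subseteq> K \<and> (\<forall>x\<in>K. \<forall>y\<in>K. x + y \<in> F \<longrightarrow> x \<in> F \<and> y \<in> F)"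

text \<open>Faces and invariant faces are closed under intersection and include \<open>K\<close> itself (for
  \<open>A \<in> cone_preserving K\<close> in the invariant case), so for \<open>S \<subseteq> K\<close> the hulls
  below are the smallest (invariant) faces including \<open>S\<close>.\<close>

definition face_gen :: "'a::real_vector set \<Rightarrow> 'a set \<Rightarrow> 'a set" where
  "face_gen K S = cone_face K hull S"

definition face_join :: "'a::real_vector set \<Rightarrow> 'a set \<Rightarrow> 'a set \<Rightarrow> 'a set" where
  "face_join K F G = face_gen K (F \<union> G)"

definition invariant_face_gen ::
    "(real ^ 'n) set \<Rightarrow> real ^ 'n ^ 'n \<Rightarrow> (real ^ 'n) set \<Rightarrow> (real ^ 'n) set" where
  "invariant_face_gen K A S = (\<lambda>F. cone_face K F \<and> (*v) A ` F \<subseteq> F) hull S"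


subsection \<open>Spectral pairs\<close>

text \<open>The operator \<open>(^)\<close> on the vector type is the componentwise power, hence a separate
  matrix power.\<close>

primrec mat_power :: "'a::semiring_1 ^ 'n ^ 'n \<Rightarrow> nat \<Rightarrow> 'a ^ 'n ^ 'n" where
  "mat_power A 0 = mat 1"
| "mat_power A (Suc k) = A ** mat_power A k"

definition gen_eigenvector :: "complex ^ 'n ^ 'n \<Rightarrow> complex \<Rightarrow> complex ^ 'n \<Rightarrow> bool" where
  "gen_eigenvector A \<mu> x \<longleftrightarrow> x \<noteq> 0 \<and> (\<exists>k>0. mat_power (mat \<mu> - A) k *v x = 0)"

definition gen_eigenvector_order :: "complex ^ 'n ^ 'n \<Rightarrow> complex \<Rightarrow> complex ^ 'n \<Rightarrow> nat" where
  "gen_eigenvector_order A \<mu> x = (LEAST k. k > 0 \<and> mat_power (mat \<mu> - A) k *v x = 0)"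

text \<open>A decomposition \<open>x = x\<^sub>1 + \<dots> + x\<^sub>m\<close> into generalized eigenvectors for
  distinct eigenvalues is encoded as a finitely supported function \<open>c\<close> sending an
  eigenvalue to its summand; the \<open>x\<^sub>i\<close> are the nonzero values of \<open>c\<close>.\<close>

definition gen_eigen_decomp ::
    "complex ^ 'n ^ 'n \<Rightarrow> complex ^ 'n \<Rightarrow> (complex \<Rightarrow> complex ^ 'n) \<Rightarrow> bool" where
  "gen_eigen_decomp A x c \<longleftrightarrow>
     finite {\<mu>. c \<mu> \<noteq> 0} \<and>
     (\<forall>\<mu>. c \<mu> \<noteq> 0 \<longrightarrow> gen_eigenvector A \<mu> (c \<mu>)) \<and>
     x = (\<Sum>\<mu> | c \<mu> \<noteq> 0. c \<mu>)"

definition gen_eigen_part ::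
    "complex ^ 'n ^ 'n \<Rightarrow> complex ^ 'n \<Rightarrow> complex \<Rightarrow> complex ^ 'n" where
  "gen_eigen_part A x = (THE c. gen_eigen_decomp A x c)"

text \<open>The next two notions are meaningful only for \<open>x \<noteq> 0\<close>; for \<open>x = 0\<close>
  the sets are empty.\<close>

definition local_spectral_radius :: "complex ^ 'n ^ 'n \<Rightarrow> complex ^ 'n \<Rightarrow> real" where
  "local_spectral_radius A x = Max {cmod \<mu> | \<mu>. gen_eigen_part A x \<mu> \<noteq> 0}"

definition local_order :: "complex ^ 'n ^ 'n \<Rightarrow> complex ^ 'n \<Rightarrow> nat" where
  "local_order A x =
     Max {gen_eigenvector_order A \<mu> (gen_eigen_part A x \<mu>) | \<mu>.
            gen_eigen_part A x \<mu> \<noteq> 0 \<and> cmod \<mu> = local_spectral_radius A x}"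

definition spectral_pair :: "complex ^ 'n ^ 'n \<Rightarrow> complex ^ 'n \<Rightarrow> real \<times> real" where
  "spectral_pair A x =
     (if x = 0 then (0, 0) else (local_spectral_radius A x, real (local_order A x)))"

definition sp :: "real ^ 'n ^ 'n \<Rightarrow> real ^ 'n \<Rightarrow> real \<times> real" where
  "sp A x = spectral_pair (map_matrix complex_of_real A) (\<chi> i. complex_of_real (x $ i))"

text \<open>The common value of \<open>sp A\<close> on the relative interior of a face.\<close>

definition sp_face :: "real ^ 'n ^ 'n \<Rightarrow> (real ^ 'n) set \<Rightarrow> real \<times> real" where
  "sp_face A F = (THE p. sp A ` rel_interior F = {p})"

text \<open>The order \<open>(\<le>)\<close> that HOL-Analysis puts on pairs is the componentwise one.\<close>

definition lex_le :: "real \<times> real \<Rightarrow> real \<times> real \<Rightarrow> bool" (infix \<open>\<preceq>\<close> 50) where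
  "p \<preceq> q \<longleftrightarrow> fst p < fst q \<or> fst p = fst q \<and> snd p \<le> snd q"

definition lex_max :: "real \<times> real \<Rightarrow> real \<times> real \<Rightarrow> real \<times> real" where
  "lex_max p q = (if p \<preceq> q then q else p)"

end

theory Submission
  imports Defs "HOL-Computational_Algebra.Fundamental_Theorem_Algebra"
begin

text \<open>The spectral pair is a growth rate: for \<open>r > 0\<close>, \<open>sp A x \<preceq> (r, k)\<close> holds iff
  \<open>\<parallel>A\<^sup>m x\<parallel> \<le> C (m + 1)\<^sup>k\<^sup>-\<^sup>1 r\<^sup>m\<close> for some \<open>C\<close> and all \<open>m\<close>, and \<open>sp A x \<preceq> (0, k)\<close> holds iff
  \<open>A\<^sup>k x = 0\<close>. A proper cone is normal, so \<open>0 \<le> x \<le> y\<close> in the cone order bounds \<open>\<parallel>A\<^sup>m x\<parallel>\<close> by a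
  constant times \<open>\<parallel>A\<^sup>m y\<parallel>\<close> uniformly in \<open>m\<close>, whence \<open>sp A x \<preceq> sp A y\<close>. Consequently the sublevel sets
  \<open>{z \<in> K. sp A z \<preceq> sp A y}\<close> are \<open>A\<close>-invariant faces of \<open>K\<close>, and the spectral pair of a face is the
  maximum of the spectral pairs of its elements.\<close>

subsection \<open>Decomposition into generalized eigenvectors\<close>

lemma mat_power_Suc_apply: "mat_power A (Suc k) *v x = A *v (mat_power A k *v x)"
  by (simp add: matrix_vector_mul_assoc)

lemma mat_power_commute:
  assumes "A ** B = B ** A"
  shows "mat_power A k ** B = B ** mat_power A k"
proof (induction k)
  case (Suc k)
  then show ?case
    by (metis assms mat_power.simps(2) matrix_mul_assoc)
qed simp

lemma mat_power_add: "mat_power A (j + k) = mat_power A j ** mat_power A k"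
  by (induction j) (simp_all add: matrix_mul_assoc)

lemma mat_power_Suc_right: "mat_power A (Suc k) *v x = mat_power A k *v (A *v x)"
  using mat_power_commute[of A A k] by (simp add: matrix_vector_mul_assoc)

lemma mat_power_commute_vec:
  assumes "A ** B = B ** A"
  shows "mat_power A k *v (B *v x) = B *v (mat_power A k *v x)"
  using mat_power_commute[OF assms] by (simp add: matrix_vector_mul_assoc)

lemma mat_power_kernel_mono:
  assumes "mat_power A k *v x = 0" "k \<le> l"
  shows "mat_power A l *v x = 0"
proof -
  have "mat_power A l = mat_power A (l - k) ** mat_power A k"
    using assms(2) by (simp flip: mat_power_add)
  then show ?thesis
    by (simp flip: matrix_vector_mul_assoc add: assms(1))
qed

lemma mat_vec: "mat c *v (x :: 'a::semiring_1 ^ 'n) = c *s x"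
  by (simp add: vec_eq_iff matrix_vector_mult_def mat_def if_distrib[of "\<lambda>t. t * _"] cong: if_cong)

lemma mat_minus_vec: "(mat c - A) *v x = c *s x - A *v (x :: 'a::field ^ 'n)"
  by (simp add: matrix_vector_mult_diff_rdistrib mat_vec)

lemma mat_minus_commute:
  "(mat c - A) ** (mat d - A) = (mat d - A) ** (mat c - (A :: 'a::field ^ 'n ^ 'n))"
proof -
  have "(mat c - A) *v ((mat d - A) *v x) = (mat d - A) *v ((mat c - A) *v x)" for x
    by (simp add: mat_minus_vec vec.diff vec.scale vec.scale_right_diff_distrib mult.commute)
  then show ?thesis
    by (simp add: matrix_eq flip: matrix_vector_mul_assoc)
qed

lemma mat_minus_commute_self:
  "(mat c - A) ** A = A ** (mat c - (A :: 'a::field ^ 'n ^ 'n))"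
proof -
  have "(mat c - A) *v (A *v x) = A *v ((mat c - A) *v x)" for x
    by (simp add: mat_minus_vec vec.diff vec.scale)
  then show ?thesis
    by (simp add: matrix_eq flip: matrix_vector_mul_assoc)
qed

section \<open>Invariant subspaces and sums of generalized eigenvectors\<close>

definition invariant_subspace :: "'a::field ^ 'n ^ 'n \<Rightarrow> ('a ^ 'n) set \<Rightarrow> bool" where
  "invariant_subspace A S \<longleftrightarrow> vec.subspace S \<and> (\<forall>x\<in>S. A *v x \<in> S)"

lemma invariant_subspace_zero: "invariant_subspace A {0}"
  by (simp add: invariant_subspace_def vec.subspace_0)

lemma invariant_subspace_kernel:
  "invariant_subspace A {x. mat_power (mat c - A) k *v x = 0}"
  by (auto simp: invariant_subspace_def vec.subspace_def vec.add vec.scale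
      mat_power_commute_vec[OF mat_minus_commute_self])

lemma invariant_subspace_mat_minus:
  assumes "invariant_subspace A S" "x \<in> S"
  shows "(mat c - A) *v x \<in> S"
  using assms unfolding invariant_subspace_def mat_minus_vec
  by (auto intro: vec.subspace_diff vec.subspace_scale)

lemma invariant_subspace_mat_power:
  assumes "invariant_subspace A S" "x \<in> S"
  shows "mat_power (mat c - A) k *v x \<in> S"
  by (induction k)
    (use assms invariant_subspace_mat_minus in \<open>auto simp: mat_power_Suc_apply simp del: mat_power.simps(2)\<close>)

text \<open>On a generalized eigenspace, \<open>A - d\<close> for any other scalar \<open>d\<close> is invertible
  modulo every invariant subspace.\<close>

lemma invariant_subspace_cancel:
  assumes S: "invariant_subspace A S" and "c \<noteq> d"
  shows "mat_power (mat c - A) k *v x = 0 \<Longrightarrow> (mat d - A) *v x \<in> S \<Longrightarrow> x \<in> S"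
proof (induction k arbitrary: x)
  case 0
  then show ?case
    using S by (simp add: invariant_subspace_def vec.subspace_0)
next
  case (Suc k)
  define y where "y = (mat c - A) *v x"
  have "(mat d - A) *v y = (mat c - A) *v ((mat d - A) *v x)"
    unfolding y_def using mat_minus_commute[of c A d] by (simp add: matrix_vector_mul_assoc)
  then have "(mat d - A) *v y \<in> S"
    using Suc.prems(2) S by (simp add: invariant_subspace_mat_minus)
  moreover have "mat_power (mat c - A) k *v y = 0"
    using Suc.prems(1) unfolding y_def mat_power_Suc_right .
  ultimately have "y \<in> S"
    using Suc.IH by blast
  \<comment> \<open>The shifts by \<open>d\<close> and by \<open>c\<close> differ by the nonzero
    scalar \<open>d - c\<close>, so a multiple of \<open>x\<close> is a difference of two elements
    of \<open>S\<close>.\<close>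
  have "(d - c) *s x = (mat d - A) *v x - y"
    by (simp add: y_def mat_minus_vec vec.scale_left_diff_distrib)
  then have "(d - c) *s x \<in> S"
    using \<open>y \<in> S\<close> Suc.prems(2) S by (simp add: invariant_subspace_def vec.subspace_diff)
  then have "inverse (d - c) *s ((d - c) *s x) \<in> S"
    using S unfolding invariant_subspace_def by (blast intro: vec.subspace_scale)
  then show ?case
    using \<open>c \<noteq> d\<close> unfolding vec.scale_scale by simp
qed

lemma kernel_mat_power:
  fixes A :: "'a::field ^ 'n ^ 'n"
  assumes "mat_power (mat c - A) k *v x = 0"
  shows "mat_power (mat c - A) k *v (mat_power (mat d - A) j *v x) = 0"
  using invariant_subspace_mat_power[OF invariant_subspace_kernel[of A c k]] assms by blast

lemma invariant_subspace_cancel_power: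
  fixes A :: "'a::field ^ 'n ^ 'n"
  assumes S: "invariant_subspace A S" and "c \<noteq> d" and x: "mat_power (mat c - A) k *v x = 0"
  shows "mat_power (mat d - A) j *v x \<in> S \<Longrightarrow> x \<in> S"
proof (induction j)
  case (Suc j)
  have "mat_power (mat c - A) k *v (mat_power (mat d - A) j *v x) = 0"
    using x by (rule kernel_mat_power)
  then have "mat_power (mat d - A) j *v x \<in> S"
    using invariant_subspace_cancel[OF S \<open>c \<noteq> d\<close>] Suc.prems by (simp add: mat_power_Suc_apply del: mat_power.simps(2))
  then show ?case
    by (rule Suc.IH)
qed simp

text \<open>Induction on \<open>I\<close>: the power of \<open>mat d - A\<close> that kills
  \<open>x d\<close> removes this summand and keeps the others in their kernels, so the induction
  hypothesis applies to their images. Cancelling the power, which is possible modulo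
  \<open>S\<close> since \<open>c \<noteq> d\<close>, recovers the summands themselves, and
  \<open>x d\<close> is the rest of the sum. The case \<open>S = {0}\<close> gives uniqueness of the
  decomposition; growth spaces as \<open>S\<close> pass a growth bound on to the parts.\<close>

lemma invariant_subspace_components:
  fixes A :: "'a::field ^ 'n ^ 'n"
  assumes S: "invariant_subspace A S" and "finite I"
  shows "(\<And>c. c \<in> I \<Longrightarrow> \<exists>k. mat_power (mat c - A) k *v x c = 0) \<Longrightarrow> sum x I \<in> S
    \<Longrightarrow> \<forall>c\<in>I. x c \<in> S"
  using \<open>finite I\<close>
proof (induction I arbitrary: x)
  case (insert d I)
  obtain j where j: "mat_power (mat d - A) j *v x d = 0"
    using insert.prems(1) by blast
  let ?y = "\<lambda>c. mat_power (mat d - A) j *v x c"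
  have "sum ?y I = mat_power (mat d - A) j *v sum x (insert d I)"
    using insert.hyps j by (simp add: vec.add vec.sum)
  then have "sum ?y I \<in> S"
    using insert.prems(2) invariant_subspace_mat_power[OF S] by metis
  moreover have "\<exists>k. mat_power (mat c - A) k *v ?y c = 0" if "c \<in> I" for c
    using insert.prems(1)[of c] that kernel_mat_power by blast
  ultimately have y: "\<forall>c\<in>I. ?y c \<in> S"
    by (intro insert.IH)
  have I: "\<forall>c\<in>I. x c \<in> S"
  proof
    fix c assume "c \<in> I"
    then have "c \<noteq> d" using insert.hyps by auto
    moreover obtain k where "mat_power (mat c - A) k *v x c = 0"
      using insert.prems(1) \<open>c \<in> I\<close> by blast
    ultimately show "x c \<in> S"
      using invariant_subspace_cancel_power[OF S] y \<open>c \<in> I\<close> by blast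
  qed
  have "sum x I \<in> S"
    using S I unfolding invariant_subspace_def by (blast intro: vec.subspace_sum)
  then have "sum x (insert d I) - sum x I \<in> S"
    using S insert.prems(2) unfolding invariant_subspace_def by (blast intro: vec.subspace_diff)
  then have "x d \<in> S"
    using insert.hyps by simp
  with I show ?case by simp
qed simp

section \<open>Existence of the decomposition\<close>

lemma kernel_surj:
  fixes A :: "'a::field ^ 'n ^ 'n"
  assumes "c \<noteq> d"
  shows "mat_power (mat c - A) k *v x = 0 \<Longrightarrow>
    \<exists>y. mat_power (mat c - A) k *v y = 0 \<and> (mat d - A) *v y = x"
proof (induction k arbitrary: x)
  case 0
  then show ?case by (auto intro!: exI[of _ 0])
next
  case (Suc k)
  have "mat_power (mat c - A) k *v ((mat c - A) *v x) = 0"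
    using Suc.prems unfolding mat_power_Suc_right .
  then obtain z where z: "mat_power (mat c - A) k *v z = 0" "(mat d - A) *v z = (mat c - A) *v x"
    using Suc.IH by blast
  \<comment> \<open>On this kernel \<open>mat d - A\<close> is the scalar \<open>d - c\<close> plus
    the nilpotent \<open>mat c - A\<close>. As \<open>z\<close> has image
    \<open>(mat c - A) *v x\<close>, the difference \<open>x - z\<close> is mapped to
    \<open>(d - c) *s x\<close>.\<close>
  define y where "y = inverse (d - c) *s (x - z)"
  have "mat_power (mat c - A) (Suc k) *v z = 0"
    using mat_power_kernel_mono[OF z(1)] le_SucI by blast
  then have "mat_power (mat c - A) (Suc k) *v y = 0"
    using Suc.prems by (simp add: y_def vec.scale vec.diff)
  moreover have xz: "(mat d - A) *v (x - z) = (d - c) *s x"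
    by (simp add: vec.diff z(2)) (simp add: mat_minus_vec vec.scale_left_diff_distrib)
  then have "(mat d - A) *v y = x"
    using \<open>c \<noteq> d\<close> unfolding y_def vec.scale xz vec.scale_scale by simp
  ultimately show ?case by blast
qed

text \<open>An introduction rule that tolerates zero summands and the exponent \<open>0\<close>: the
  former drop out of the support, and passing to \<open>Suc k\<close> supplies the positive
  exponent.\<close>

lemma gen_eigen_decompI:
  assumes "finite I" "\<And>c. c \<in> I \<Longrightarrow> \<exists>k. mat_power (mat c - A) k *v x c = 0"
  shows "gen_eigen_decomp A (sum x I) (\<lambda>c. if c \<in> I then x c else 0)"
proof -
  have eq: "{c. (if c \<in> I then x c else 0) \<noteq> 0} = {c\<in>I. x c \<noteq> 0}" by auto
  have "gen_eigenvector A c (x c)" if "c \<in> I" "x c \<noteq> 0" for c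
  proof -
    obtain k where "mat_power (mat c - A) k *v x c = 0" using assms(2)[OF \<open>c \<in> I\<close>] by blast
    then show ?thesis
      using that mat_power_kernel_mono[of "mat c - A" k "x c" "Suc k"]
      unfolding gen_eigenvector_def by (auto intro!: exI[of _ "Suc k"])
  qed
  moreover have "sum x I = (\<Sum>c\<in>{c\<in>I. x c \<noteq> 0}. if c \<in> I then x c else 0)"
    using assms(1) by (intro sum.mono_neutral_cong_right) auto
  ultimately show ?thesis
    using assms(1) unfolding gen_eigen_decomp_def eq by simp
qed

text \<open>For \<mu> other than \<open>d\<close>, each component has a preimage under
  \<open>mat d - A\<close> in its own kernel. Subtracting these preimages from \<open>x\<close>
  leaves a vector whose image is the component at \<open>d\<close>, hence a vector killed by a power
  of \<open>mat d - A\<close>.\<close>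

lemma gen_eigen_decomp_step:
  assumes "gen_eigen_decomp A ((mat d - A) *v x) c"
  shows "\<exists>c'. gen_eigen_decomp A x c'"
proof -
  define I where "I = {\<mu>. c \<mu> \<noteq> 0}"
  have I: "finite I" "(mat d - A) *v x = sum c I"
    and c: "\<exists>k. mat_power (mat \<mu> - A) k *v c \<mu> = 0" for \<mu>
    using assms unfolding gen_eigen_decomp_def gen_eigenvector_def I_def
    by (simp_all, metis mat_power.simps(1) matrix_vector_mul_lid)
  have "\<exists>y k. mat_power (mat \<mu> - A) k *v y = 0 \<and> (mat d - A) *v y = c \<mu>" if "\<mu> \<noteq> d" for \<mu>
    using kernel_surj[OF that] c by metis
  then obtain y where y: "\<And>\<mu>. \<mu> \<noteq> d \<Longrightarrow> \<exists>k. mat_power (mat \<mu> - A) k *v y \<mu> = 0"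
      "\<And>\<mu>. \<mu> \<noteq> d \<Longrightarrow> (mat d - A) *v y \<mu> = c \<mu>"
    by metis
  define z where "z = x - sum y (I - {d})"
  have "(mat d - A) *v z = sum c I - sum c (I - {d})"
    by (simp add: z_def vec.diff vec.sum I y(2))
  also have "\<dots> = (if d \<in> I then c d else 0)"
    using I(1) by (simp add: sum_diff1)
  finally obtain k where "mat_power (mat d - A) k *v ((mat d - A) *v z) = 0"
    using c[of d] by (metis vec.zero)
  then have z: "\<exists>k. mat_power (mat d - A) k *v z = 0"
    by (metis mat_power_Suc_right)
  define w where "w \<mu> = (if \<mu> = d then z else y \<mu>)" for \<mu>
  have "sum w (insert d I) = z + sum w (I - {d})"
    using sum.insert_remove[OF I(1), of w d] by (simp add: w_def)
  also have "sum w (I - {d}) = sum y (I - {d})"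
    by (simp add: w_def)
  finally have "sum w (insert d I) = x"
    by (simp add: z_def)
  moreover have "\<exists>k. mat_power (mat \<mu> - A) k *v w \<mu> = 0" for \<mu>
    using y z by (simp add: w_def)
  ultimately show ?thesis
    using gen_eigen_decompI[of "insert d I" A w] I(1) by auto
qed

text \<open>Induction on the degree. A nonzero constant forces \<open>x = 0\<close>; otherwise a
  root \<open>d\<close> splits off a linear factor, the cofactor \<open>q\<close> annihilates
  \<open>(mat d - A) *v x\<close>, and the factor is undone by
  \<open>gen_eigen_decomp_step\<close>.\<close>

lemma poly_annihilates_exists_decomp:
  fixes p :: "complex poly"
  assumes "p \<noteq> 0" "(\<Sum>i\<le>degree p. coeff p i *s (mat_power A i *v x)) = 0"
  shows "\<exists>c. gen_eigen_decomp A x c"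
  using assms
proof (induction "degree p" arbitrary: p x)
  case 0
  then have "coeff p 0 \<noteq> 0" by (metis leading_coeff_0_iff)
  with 0 have "x = 0" by simp
  then show ?case
    using gen_eigen_decompI[of "{}"] by auto
next
  case (Suc n)
  have "\<not> constant (poly p)"
    using Suc.hyps(2) by (simp add: constant_degree)
  then obtain d where "poly p d = 0"
    using fundamental_theorem_of_algebra by blast
  then obtain q where q: "p = [:-d, 1:] * q"
    by (meson poly_eq_0_iff_dvd dvdE)
  have "q \<noteq> 0" using q Suc.prems(1) by auto
  have deg: "degree p = Suc (degree q)"
    unfolding q using \<open>q \<noteq> 0\<close> by (subst degree_mult_eq) auto
  have cp: "coeff p 0 = - d * coeff q 0" "coeff p (Suc i) = coeff q i - d * coeff q (Suc i)" for i
    unfolding q by (simp_all add: coeff_pCons)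
  let ?f = "\<lambda>i. mat_power A i *v x"
  \<comment> \<open>Comparison of coefficients shows that \<open>q\<close> at \<open>A\<close>
    applied to \<open>(mat d - A) *v x\<close> is minus \<open>p\<close> at \<open>A\<close> applied
    to \<open>x\<close>.\<close>
  have "(\<Sum>i\<le>degree q. coeff q i *s (mat_power A i *v ((mat d - A) *v x)))
      = d *s (\<Sum>i\<le>degree q. coeff q i *s ?f i) - (\<Sum>i\<le>degree q. coeff q i *s ?f (Suc i))"
    by (simp add: mat_minus_vec vec.diff vec.scale vec.scale_right_diff_distrib sum_subtractf
        vec.scale_sum_right mult.commute del: mat_power.simps(2) flip: mat_power_Suc_right)
  \<comment> \<open>Appending the vanishing coefficient of index \<open>Suc (degree q)\<close> lets
    the index shift below produce sums over the same range.\<close>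
  also have "(\<Sum>i\<le>degree q. coeff q i *s ?f i) = (\<Sum>i\<le>Suc (degree q). coeff q i *s ?f i)"
    by (simp add: coeff_eq_0 del: mat_power.simps)
  also have "\<dots> = coeff q 0 *s ?f 0 + (\<Sum>i\<le>degree q. coeff q (Suc i) *s ?f (Suc i))"
    by (rule sum.atMost_Suc_shift)
  also have "d *s \<dots> - (\<Sum>i\<le>degree q. coeff q i *s ?f (Suc i))
      = - (coeff p 0 *s ?f 0 + (\<Sum>i\<le>degree q. coeff p (Suc i) *s ?f (Suc i)))"
    by (simp add: cp vec.scale_right_distrib vec.scale_left_diff_distrib sum_subtractf vec.scale_sum_right
         del: mat_power.simps)
  also have "coeff p 0 *s ?f 0 + (\<Sum>i\<le>degree q. coeff p (Suc i) *s ?f (Suc i))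
      = (\<Sum>i\<le>degree p. coeff p i *s ?f i)"
    unfolding deg by (rule sum.atMost_Suc_shift[symmetric])
  also have "\<dots> = 0" by (rule Suc.prems)
  finally have "\<exists>c. gen_eigen_decomp A ((mat d - A) *v x) c"
    using Suc.hyps(1)[of q] Suc.hyps(2) deg \<open>q \<noteq> 0\<close> by simp
  then show ?case
    using gen_eigen_decomp_step by blast
qed

text \<open>The vectors \<open>A^i x\<close> with \<open>i \<le> n\<close> are \<open>n + 1\<close>
  vectors in dimension \<open>n\<close>. Linear dependence is a property of the set of values, so a
  repetition among them is treated separately, by a difference of two monomials.\<close>

lemma exists_annihilating_poly:
  fixes A :: "'a::field ^ 'n ^ 'n"
  shows "\<exists>p. p \<noteq> 0 \<and> (\<Sum>i\<le>degree p. coeff p i *s (mat_power A i *v x)) = 0"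
proof -
  let ?f = "\<lambda>i. mat_power A i *v x"
  have deg: "(\<Sum>i\<le>degree p. coeff p i *s ?f i) = (\<Sum>i\<le>N. coeff p i *s ?f i)"
    if "degree p \<le> N" for p N
    using that by (intro sum.mono_neutral_left) (auto simp: coeff_eq_0)
  show ?thesis
  proof (cases "inj_on ?f {..CARD('n)}")
    case False
    then obtain i j where ij: "i \<noteq> j" "?f i = ?f j"
      unfolding inj_on_def by blast
    define p :: "'a poly" where "p = monom 1 i - monom 1 j"
    have "coeff p i = 1" using ij by (simp add: p_def)
    then have "p \<noteq> 0" by auto
    moreover have "degree p \<le> max i j"
      unfolding p_def by (metis degree_diff_le_max degree_monom_eq zero_neq_one)
    then have "(\<Sum>l\<le>degree p. coeff p l *s ?f l) = (\<Sum>l\<le>max i j. coeff p l *s ?f l)"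
      by (rule deg)
    moreover have "\<dots> = (\<Sum>l\<le>max i j. (if l = i then ?f l else 0)) - (\<Sum>l\<le>max i j. (if l = j then ?f l else 0))"
      unfolding sum_subtractf[symmetric] using ij(1)
      by (intro sum.cong) (auto simp: p_def)
    moreover have "\<dots> = 0" using ij(2) by simp
    ultimately show ?thesis by metis
  next
    case True
    have "card (?f ` {..CARD('n)}) = Suc (CARD('n))"
      using True by (simp add: card_image)
    then have "vec.dependent (?f ` {..CARD('n)})"
      using vec.dim_subset_UNIV[of "?f ` {..CARD('n)}"]
      by (intro vec.dependent_biggerset_general) (simp add: vec.dimension_def card_cart_basis)
    then obtain u v where u: "(\<Sum>w\<in>?f ` {..CARD('n)}. u w *s w) = 0"
      "v \<in> ?f ` {..CARD('n)}" "u v \<noteq> 0"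
      using vec.dependent_finite[of "?f ` {..CARD('n)}"] by auto
    then obtain i where i: "i \<le> CARD('n)" "u (?f i) \<noteq> 0" by auto
    define p where "p = (\<Sum>l\<le>CARD('n). monom (u (?f l)) l)"
    have cp: "coeff p l = (if l \<le> CARD('n) then u (?f l) else 0)" for l
      by (simp add: p_def coeff_sum)
    have "p \<noteq> 0" using cp[of i] i by auto
    moreover have "degree p \<le> CARD('n)"
      by (intro degree_le) (auto simp: cp)
    then have "(\<Sum>l\<le>degree p. coeff p l *s ?f l) = (\<Sum>l\<le>CARD('n). coeff p l *s ?f l)"
      by (rule deg)
    moreover have "\<dots> = (\<Sum>l\<le>CARD('n). u (?f l) *s ?f l)"
      by (intro sum.cong) (auto simp: cp)
    moreover have "\<dots> = 0"
      using u(1) True by (simp add: sum.reindex)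
    ultimately show ?thesis by metis
  qed
qed

lemma gen_eigen_decomp_exists: "\<exists>c. gen_eigen_decomp A x c"
  using exists_annihilating_poly poly_annihilates_exists_decomp by blast

section \<open>Uniqueness of the decomposition and the parts of a vector\<close>

lemma gen_eigen_decomp_kernel:
  assumes "gen_eigen_decomp A x c"
  shows "\<exists>k. mat_power (mat \<mu> - A) k *v c \<mu> = 0"
  using assms unfolding gen_eigen_decomp_def gen_eigenvector_def
  by (metis mat_power.simps(1) matrix_vector_mul_lid)

text \<open>The differences of corresponding summands lie in kernels for distinct scalars and sum to
  zero, so each of them lies in the invariant subspace \<open>{0}\<close>.\<close>

lemma gen_eigen_decomp_unique:
  assumes "gen_eigen_decomp A x c" "gen_eigen_decomp A x c'"
  shows "c = c'"
proof
  define I where "I = {\<mu>. c \<mu> \<noteq> 0} \<union> {\<mu>. c' \<mu> \<noteq> 0}"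
  define d where "d \<mu> = c \<mu> - c' \<mu>" for \<mu>
  have fin: "finite I" using assms by (simp add: I_def gen_eigen_decomp_def)
  have "sum c {\<mu>. c \<mu> \<noteq> 0} = sum c I" "sum c' {\<mu>. c' \<mu> \<noteq> 0} = sum c' I"
    using fin by (auto simp: I_def intro!: sum.mono_neutral_left)
  then have "x = sum c I" "x = sum c' I"
    using assms by (simp_all add: gen_eigen_decomp_def)
  then have sum: "sum d I \<in> {0}"
    by (simp add: sum_subtractf d_def)
  have ker: "\<exists>k. mat_power (mat \<mu> - A) k *v d \<mu> = 0" for \<mu>
  proof -
    obtain k l where "mat_power (mat \<mu> - A) k *v c \<mu> = 0" "mat_power (mat \<mu> - A) l *v c' \<mu> = 0"
      using assms gen_eigen_decomp_kernel by metis
    then have "mat_power (mat \<mu> - A) (max k l) *v d \<mu> = 0"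
      using mat_power_kernel_mono[of "mat \<mu> - A" k "c \<mu>" "max k l"]
        mat_power_kernel_mono[of "mat \<mu> - A" l "c' \<mu>" "max k l"] by (simp add: vec.diff d_def)
    then show ?thesis ..
  qed
  have d: "\<forall>\<mu>\<in>I. d \<mu> \<in> {0}"
    using ker sum by (rule invariant_subspace_components[OF invariant_subspace_zero fin])
  show "c \<mu> = c' \<mu>" for \<mu>
    using bspec[OF d, of \<mu>] by (cases "\<mu> \<in> I") (simp_all add: I_def d_def)
qed

lemma gen_eigen_part_eq: "gen_eigen_decomp A x c \<Longrightarrow> gen_eigen_part A x = c"
  unfolding gen_eigen_part_def using gen_eigen_decomp_unique by blast

text \<open>Existence and uniqueness give meaning to the definite description in
  \<open>gen_eigen_part\<close>.\<close>

lemma gen_eigen_part_decomp: "gen_eigen_decomp A x (gen_eigen_part A x)"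
  using gen_eigen_decomp_exists gen_eigen_part_eq by metis

lemma gen_eigen_part_finite: "finite {\<mu>. gen_eigen_part A x \<mu> \<noteq> 0}"
  and gen_eigen_part_sum: "(\<Sum>\<mu> | gen_eigen_part A x \<mu> \<noteq> 0. gen_eigen_part A x \<mu>) = x"
  and gen_eigen_part_gen_eigenvector: "gen_eigen_part A x \<mu> \<noteq> 0 \<Longrightarrow> gen_eigenvector A \<mu> (gen_eigen_part A x \<mu>)"
  and gen_eigen_part_kernel: "\<exists>k. mat_power (mat \<mu> - A) k *v gen_eigen_part A x \<mu> = 0"
  using gen_eigen_part_decomp[of A x] gen_eigen_decomp_kernel[OF gen_eigen_part_decomp]
  unfolding gen_eigen_decomp_def by metis+

lemma gen_eigen_part_in_invariant_subspace:
  assumes "invariant_subspace A S" "x \<in> S"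
  shows "gen_eigen_part A x \<mu> \<in> S"
proof (cases "gen_eigen_part A x \<mu> = 0")
  case True
  then show ?thesis using assms by (simp add: invariant_subspace_def vec.subspace_0)
next
  case False
  have "sum (gen_eigen_part A x) {\<mu>. gen_eigen_part A x \<mu> \<noteq> 0} \<in> S"
    using assms(2) by (simp only: gen_eigen_part_sum)
  with gen_eigen_part_kernel have "\<forall>\<mu>\<in>{\<mu>. gen_eigen_part A x \<mu> \<noteq> 0}. gen_eigen_part A x \<mu> \<in> S"
    by (rule invariant_subspace_components[OF assms(1) gen_eigen_part_finite])
  with False show ?thesis by simp
qed

subsection \<open>Spectral pairs and growth of powers\<close>

lemma gen_eigenvector_order_le_iff:
  assumes "gen_eigenvector A \<mu> x" "0 < k"
  shows "gen_eigenvector_order A \<mu> x \<le> k \<longleftrightarrow> mat_power (mat \<mu> - A) k *v x = 0"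
proof
  let ?P = "\<lambda>k. k > 0 \<and> mat_power (mat \<mu> - A) k *v x = 0"
  have "?P (gen_eigenvector_order A \<mu> x)"
    using assms(1) unfolding gen_eigenvector_order_def gen_eigenvector_def
    by (metis (mono_tags, lifting) LeastI_ex)
  then show "mat_power (mat \<mu> - A) k *v x = 0" if "gen_eigenvector_order A \<mu> x \<le> k"
    using mat_power_kernel_mono that by blast
  show "gen_eigenvector_order A \<mu> x \<le> k" if "mat_power (mat \<mu> - A) k *v x = 0"
    unfolding gen_eigenvector_order_def using that assms(2) by (simp add: Least_le)
qed

lemma gen_eigenvector_order_pos:
  assumes "gen_eigenvector A \<mu> x"
  shows "0 < gen_eigenvector_order A \<mu> x"
  using assms unfolding gen_eigenvector_order_def gen_eigenvector_def
  by (metis (mono_tags, lifting) LeastI_ex)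

lemma gen_eigen_part_nonzero_ex:
  assumes "x \<noteq> 0"
  shows "\<exists>\<mu>. gen_eigen_part A x \<mu> \<noteq> 0"
  using assms gen_eigen_part_sum[of A x] by (metis (mono_tags, lifting) mem_Collect_eq sum.neutral)

lemma local_spectral_radius_attained:
  assumes "x \<noteq> 0"
  shows "\<exists>\<mu>. gen_eigen_part A x \<mu> \<noteq> 0 \<and> cmod \<mu> = local_spectral_radius A x"
proof -
  have "local_spectral_radius A x \<in> {cmod \<mu> | \<mu>. gen_eigen_part A x \<mu> \<noteq> 0}"
    unfolding local_spectral_radius_def
    using gen_eigen_part_nonzero_ex[OF assms] by (intro Max_in finite_image_set gen_eigen_part_finite) auto
  then show ?thesis by auto
qed

lemma local_spectral_radius_ge:
  assumes "gen_eigen_part A x \<mu> \<noteq> 0"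
  shows "cmod \<mu> \<le> local_spectral_radius A x"
  unfolding local_spectral_radius_def using assms by (intro Max_ge finite_image_set gen_eigen_part_finite) auto

lemma local_order_le_iff:
  assumes "x \<noteq> 0" "0 < k"
  shows "local_order A x \<le> k \<longleftrightarrow>
    (\<forall>\<mu>. cmod \<mu> = local_spectral_radius A x \<longrightarrow> mat_power (mat \<mu> - A) k *v gen_eigen_part A x \<mu> = 0)"
proof -
  have "local_order A x \<le> k \<longleftrightarrow>
    (\<forall>\<mu>. gen_eigen_part A x \<mu> \<noteq> 0 \<and> cmod \<mu> = local_spectral_radius A x \<longrightarrow>
      gen_eigenvector_order A \<mu> (gen_eigen_part A x \<mu>) \<le> k)"
    unfolding local_order_def
    using local_spectral_radius_attained[OF assms(1)]
    by (subst Max_le_iff[OF finite_image_set[OF finite_subset[OF _ gen_eigen_part_finite]]]) auto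
  then show ?thesis
    using gen_eigenvector_order_le_iff[OF gen_eigen_part_gen_eigenvector assms(2)] by (metis vec.zero)
qed

lemma local_order_pos:
  assumes "x \<noteq> 0"
  shows "0 < local_order A x"
proof -
  have "local_order A x \<in> {gen_eigenvector_order A \<mu> (gen_eigen_part A x \<mu>) | \<mu>.
            gen_eigen_part A x \<mu> \<noteq> 0 \<and> cmod \<mu> = local_spectral_radius A x}"
    unfolding local_order_def
    using local_spectral_radius_attained[OF assms]
    by (intro Max_in finite_image_set[OF finite_subset[OF _ gen_eigen_part_finite]]) auto
  then show ?thesis
    using gen_eigenvector_order_pos gen_eigen_part_gen_eigenvector by fastforce
qed

text \<open>Replaces the two maxima by a condition on each part separately, the form to which growth
  estimates apply. For \<open>x = 0\<close> there are no parts and both sides hold.\<close>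

lemma spectral_pair_lex_le_iff:
  assumes "0 \<le> r" "0 < k"
  shows "spectral_pair A x \<preceq> (r, real k) \<longleftrightarrow>
    (\<forall>\<mu>. gen_eigen_part A x \<mu> \<noteq> 0 \<longrightarrow>
      cmod \<mu> < r \<or> cmod \<mu> = r \<and> mat_power (mat \<mu> - A) k *v gen_eigen_part A x \<mu> = 0)"
proof (cases "x = 0")
  case True
  have "gen_eigen_part A 0 \<mu> = 0" for \<mu>
    using gen_eigen_part_in_invariant_subspace[OF invariant_subspace_zero, of 0] by simp
  with True assms show ?thesis
    by (auto simp: spectral_pair_def lex_le_def)
next
  case False
  obtain \<nu> where \<nu>: "gen_eigen_part A x \<nu> \<noteq> 0" "cmod \<nu> = local_spectral_radius A x"
    using local_spectral_radius_attained[OF False] by blast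
  have "spectral_pair A x \<preceq> (r, real k) \<longleftrightarrow> local_spectral_radius A x < r \<or>
    local_spectral_radius A x = r \<and> local_order A x \<le> k"
    using False by (simp add: spectral_pair_def lex_le_def)
  also have "\<dots> \<longleftrightarrow> (\<forall>\<mu>. gen_eigen_part A x \<mu> \<noteq> 0 \<longrightarrow>
      cmod \<mu> < r \<or> cmod \<mu> = r \<and> mat_power (mat \<mu> - A) k *v gen_eigen_part A x \<mu> = 0)"
    (is "?lhs \<longleftrightarrow> ?rhs")
  proof
    assume ?lhs
    then show ?rhs
      using local_spectral_radius_ge[of A x] unfolding local_order_le_iff[OF False assms(2)] by fastforce
  next
    assume rhs: ?rhs
    have "mat_power (mat \<mu> - A) k *v gen_eigen_part A x \<mu> = 0" if "cmod \<mu> = r" for \<mu>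
      using rhs that by (cases "gen_eigen_part A x \<mu> = 0") auto
    then show ?lhs
      using rhs \<nu> unfolding local_order_le_iff[OF False assms(2)] by metis
  qed
  finally show ?thesis .
qed

text \<open>Radius \<open>0\<close> needs its own criterion: the rate
  \<open>(m + 1)^(k - 1) * 0^m\<close> vanishes for all \<open>m > 0\<close> and so cannot see the
  order. Here the only possible part is the one at \<open>0\<close>, namely \<open>x\<close>
  itself.\<close>

lemma spectral_pair_kernel_iff:
  assumes "0 < k"
  shows "spectral_pair A x \<preceq> (0, real k) \<longleftrightarrow> mat_power A k *v x = 0"
proof -
  have ker: "mat_power (mat 0 - A) k *v y = (- 1) ^ k *s (mat_power A k *v y)" for y
  proof (induction k)
    case (Suc k)
    have "mat_power (mat 0 - A) (Suc k) *v y = - (A *v ((- 1) ^ k *s (mat_power A k *v y)))"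
      unfolding mat_power_Suc_apply Suc mat_minus_vec by simp
    then show ?case
      unfolding mat_power_Suc_apply vec.scale by simp
  qed simp
  have "spectral_pair A x \<preceq> (0, real k) \<longleftrightarrow> mat_power (mat 0 - A) k *v x = 0"
  proof
    assume "spectral_pair A x \<preceq> (0, real k)"
    then have part: "\<mu> = 0 \<and> mat_power (mat \<mu> - A) k *v gen_eigen_part A x \<mu> = 0"
      if "gen_eigen_part A x \<mu> \<noteq> 0" for \<mu>
      using spectral_pair_lex_le_iff[of 0 k A x] assms that by auto
    have "mat_power (mat 0 - A) k *v (\<Sum>\<mu> | gen_eigen_part A x \<mu> \<noteq> 0. gen_eigen_part A x \<mu>) = 0"
      unfolding vec.sum using part by (intro sum.neutral) blast
    then show "mat_power (mat 0 - A) k *v x = 0"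
      by (simp only: gen_eigen_part_sum)
  next
    assume x: "mat_power (mat 0 - A) k *v x = 0"
    then have "gen_eigen_part A x = (\<lambda>\<mu>. if \<mu> \<in> {0} then x else 0)"
      using gen_eigen_decompI[of "{0}" A "\<lambda>_. x"] by (auto intro!: gen_eigen_part_eq)
    then show "spectral_pair A x \<preceq> (0, real k)"
      using spectral_pair_lex_le_iff[of 0 k A x] assms x by auto
  qed
  then show ?thesis
    unfolding ker by simp
qed

section \<open>Growth rates and linear recurrences\<close>

lemma norm_vector_smult: "norm (c *s x) = cmod c * norm (x :: complex ^ 'n)"
  by (simp add: norm_vec_def norm_mult L2_set_right_distrib)

text \<open>The growth rate \<open>(m + 1)\<^sup>k\<^sup>-\<^sup>1 r\<^sup>m\<close> of the powers on generalized eigenvectors of order \<open>k\<close>;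
  order \<open>0\<close>, i.e. the zero vector, has rate \<open>0\<close>.\<close>

definition growth_rate :: "real \<Rightarrow> nat \<Rightarrow> nat \<Rightarrow> real" where
  "growth_rate r k m = (if k = 0 then 0 else real (m + 1) ^ (k - 1) * r ^ m)"

lemma growth_rate_nonneg: "0 \<le> r \<Longrightarrow> 0 \<le> growth_rate r k m"
  by (simp add: growth_rate_def)

text \<open>The constant comes from \<open>m + 2 \<le> 2 * (m + 1)\<close>. It makes growth bounds
  stable under an application of \<open>A\<close>.\<close>

lemma growth_rate_Suc_le:
  assumes "0 \<le> r"
  shows "growth_rate r k (Suc m) \<le> 2 ^ k * r * growth_rate r k m"
proof (cases k)
  case (Suc l)
  have "real (Suc m + 1) ^ l \<le> (2 * real (m + 1)) ^ l"
    by (intro power_mono) auto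
  also have "\<dots> \<le> 2 ^ k * real (m + 1) ^ l"
    unfolding power_mult_distrib Suc by (intro mult_right_mono power_increasing) auto
  finally have "real (Suc m + 1) ^ l * r ^ Suc m \<le> 2 ^ k * real (m + 1) ^ l * r ^ Suc m"
    using assms by (intro mult_right_mono) auto
  then show ?thesis
    using Suc by (simp add: growth_rate_def mult_ac)
qed (simp add: growth_rate_def)

lemma growth_rate_Suc_ge:
  assumes "0 \<le> r"
  shows "r * growth_rate r k m \<le> growth_rate r k (Suc m)"
proof (cases k)
  case (Suc l)
  have "real (m + 1) ^ l * r ^ Suc m \<le> real (Suc m + 1) ^ l * r ^ Suc m"
    using assms by (intro mult_right_mono power_mono) auto
  then show ?thesis
    using Suc by (simp add: growth_rate_def mult_ac)
qed (simp add: growth_rate_def)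

text \<open>For positive \<open>k\<close> this is
  \<open>(m + 1)^k + (m + 1)^(k - 1) \<le> (m + 2)^k\<close>, times a power of \<open>r\<close>; it
  closes the induction for a resonant recurrence.\<close>

lemma growth_rate_Suc_add:
  assumes "0 < r"
  shows "r * growth_rate r (Suc k) m + r * growth_rate r k m \<le> growth_rate r (Suc k) (Suc m)"
proof (cases k)
  case (Suc l)
  have "real (m + 1) ^ Suc l + real (m + 1) ^ l = (real (m + 1) + 1) * real (m + 1) ^ l"
    by (simp add: algebra_simps)
  also have "\<dots> \<le> (real (m + 1) + 1) * real (Suc m + 1) ^ l"
    by (intro mult_left_mono power_mono) auto
  also have "\<dots> = real (Suc m + 1) ^ Suc l"
    by (simp add: algebra_simps)
  finally have "(real (m + 1) ^ Suc l + real (m + 1) ^ l) * r ^ Suc m \<le> real (Suc m + 1) ^ Suc l * r ^ Suc m"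
    using assms by (intro mult_right_mono) auto
  then show ?thesis
    using Suc by (simp add: growth_rate_def algebra_simps)
qed (simp add: growth_rate_def)

text \<open>The resonant case: a forcing term of order \<open>k\<close> at the same modulus costs
  one order.\<close>

lemma linear_recurrence_growth_eq:
  fixes u g :: "nat \<Rightarrow> complex ^ 'n"
  assumes "0 < r" "cmod \<mu> = r" and u: "\<And>m. u (Suc m) = \<mu> *s u m - g m"
    and g: "\<And>m. norm (g m) \<le> C * growth_rate r k m"
  shows "\<exists>C. \<forall>m. norm (u m) \<le> C * growth_rate r (Suc k) m"
proof (intro exI allI)
  \<comment> \<open>The first entry starts the induction; the second gives
    \<open>C \<le> D * r\<close>, which absorbs the forcing term.\<close>
  define D where "D = max (norm (u 0)) (C / r)"
  have "0 \<le> D" by (simp add: D_def le_max_iff_disj)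
  have "C \<le> D * r" using assms(1) by (simp add: D_def divide_simps max_def)
  fix m show "norm (u m) \<le> D * growth_rate r (Suc k) m"
  proof (induction m)
    case 0
    show ?case by (simp add: growth_rate_def D_def)
  next
    case (Suc m)
    have "norm (u (Suc m)) \<le> r * norm (u m) + norm (g m)"
      unfolding u using norm_triangle_ineq4[of "\<mu> *s u m" "g m"] by (simp add: norm_vector_smult assms(2))
    also have "\<dots> \<le> r * (D * growth_rate r (Suc k) m) + C * growth_rate r k m"
      using Suc g assms(1) by (intro add_mono mult_left_mono) auto
    also have "\<dots> \<le> r * (D * growth_rate r (Suc k) m) + D * r * growth_rate r k m"
      using \<open>C \<le> D * r\<close> growth_rate_nonneg assms(1) by (intro add_left_mono mult_right_mono) auto
    also have "\<dots> = D * (r * growth_rate r (Suc k) m + r * growth_rate r k m)"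
      by (simp add: algebra_simps)
    also have "\<dots> \<le> D * growth_rate r (Suc k) (Suc m)"
      using growth_rate_Suc_add[OF assms(1)] \<open>0 \<le> D\<close> by (rule mult_left_mono)
    finally show ?case .
  qed
qed

text \<open>Away from resonance no order is lost: the gap \<open>r - cmod \<mu>\<close> absorbs the
  forcing term once \<open>cmod \<mu> * D + C \<le> D * r\<close>.\<close>

lemma linear_recurrence_growth_less:
  fixes u g :: "nat \<Rightarrow> complex ^ 'n"
  assumes "cmod \<mu> < r" "0 < k" and u: "\<And>m. u (Suc m) = \<mu> *s u m - g m"
    and g: "\<And>m. norm (g m) \<le> C * growth_rate r k m"
  shows "\<exists>C. \<forall>m. norm (u m) \<le> C * growth_rate r k m"
proof (intro exI allI)
  define D where "D = max (norm (u 0)) (C / (r - cmod \<mu>))"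
  have "0 \<le> D" by (simp add: D_def le_max_iff_disj)
  have "C / (r - cmod \<mu>) \<le> D" by (simp add: D_def)
  then have D: "cmod \<mu> * D + C \<le> D * r" using assms(1) by (simp add: divide_simps algebra_simps)
  have "0 \<le> r" using assms(1) norm_ge_zero[of \<mu>] by linarith
  fix m show "norm (u m) \<le> D * growth_rate r k m"
  proof (induction m)
    case 0
    show ?case using assms(2) by (simp add: growth_rate_def D_def)
  next
    case (Suc m)
    have "norm (u (Suc m)) \<le> cmod \<mu> * norm (u m) + norm (g m)"
      unfolding u using norm_triangle_ineq4[of "\<mu> *s u m" "g m"] by (simp add: norm_vector_smult)
    also have "\<dots> \<le> cmod \<mu> * (D * growth_rate r k m) + C * growth_rate r k m"
      using Suc g by (intro add_mono mult_left_mono) auto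
    also have "\<dots> = (cmod \<mu> * D + C) * growth_rate r k m"
      by (simp add: algebra_simps)
    also have "\<dots> \<le> D * r * growth_rate r k m"
      using D growth_rate_nonneg \<open>0 \<le> r\<close> by (intro mult_right_mono) auto
    also have "\<dots> \<le> D * growth_rate r k (Suc m)"
      using growth_rate_Suc_ge[OF \<open>0 \<le> r\<close>] \<open>0 \<le> D\<close> by (simp add: mult.assoc mult_left_mono)
    finally show ?case .
  qed
qed

section \<open>Vectors of bounded growth: upper bounds\<close>

definition growth_space :: "complex ^ 'n ^ 'n \<Rightarrow> real \<Rightarrow> nat \<Rightarrow> (complex ^ 'n) set" where
  "growth_space A r k = {x. \<exists>C. \<forall>m. norm (mat_power A m *v x) \<le> C * growth_rate r k m}"

text \<open>At \<open>m = 0\<close> the bound says that \<open>norm x\<close> is at most zero. This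
  starts the inductions on the order.\<close>

lemma growth_space_zero: "growth_space A r 0 = {0}"
  unfolding growth_space_def growth_rate_def
  by (auto, metis mat_power.simps(1) matrix_vector_mul_lid)

lemma invariant_subspace_growth_space:
  assumes "0 \<le> r"
  shows "invariant_subspace A (growth_space A r k)"
  unfolding invariant_subspace_def vec.subspace_def
proof (intro conjI ballI allI)
  show "0 \<in> growth_space A r k"
    unfolding growth_space_def by (auto intro!: exI[of _ 0])
next
  fix x y assume "x \<in> growth_space A r k" "y \<in> growth_space A r k"
  then obtain C D where C: "\<And>m. norm (mat_power A m *v x) \<le> C * growth_rate r k m"
    and D: "\<And>m. norm (mat_power A m *v y) \<le> D * growth_rate r k m"
    unfolding growth_space_def by blast
  have "norm (mat_power A m *v (x + y)) \<le> (C + D) * growth_rate r k m" for m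
    using norm_triangle_mono[OF C D] by (simp add: vec.add algebra_simps)
  then show "x + y \<in> growth_space A r k"
    unfolding growth_space_def by blast
next
  fix c x assume "x \<in> growth_space A r k"
  then obtain C where C: "\<And>m. norm (mat_power A m *v x) \<le> C * growth_rate r k m"
    unfolding growth_space_def by blast
  have "norm (mat_power A m *v (c *s x)) \<le> (cmod c * C) * growth_rate r k m" for m
    using mult_left_mono[OF C norm_ge_zero] by (simp add: vec.scale norm_vector_smult mult.assoc)
  then show "c *s x \<in> growth_space A r k"
    unfolding growth_space_def by blast
next
  fix x assume "x \<in> growth_space A r k"
  then obtain C where C: "\<And>m. norm (mat_power A m *v x) \<le> C * growth_rate r k m"
    unfolding growth_space_def by blast
  have "norm (mat_power A m *v (A *v x)) \<le> (\<bar>C\<bar> * 2 ^ k * r) * growth_rate r k m" for m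
  proof -
    have "norm (mat_power A m *v (A *v x)) \<le> C * growth_rate r k (Suc m)"
      using C[of "Suc m"] by (simp only: mat_power_Suc_right)
    \<comment> \<open>No sign is known for \<open>C\<close>, so its absolute value is taken before
      the rate inequality is multiplied by it.\<close>
    also have "\<dots> \<le> \<bar>C\<bar> * growth_rate r k (Suc m)"
      using growth_rate_nonneg[OF assms] by (intro mult_right_mono) auto
    also have "\<dots> \<le> \<bar>C\<bar> * (2 ^ k * r * growth_rate r k m)"
      using growth_rate_Suc_le[OF assms] by (intro mult_left_mono) auto
    finally show ?thesis by (simp add: mult.assoc)
  qed
  then show "A *v x \<in> growth_space A r k"
    unfolding growth_space_def by blast
qed

text \<open>Presents the orbit of \<open>x\<close> as a linear recurrence whose forcing term is the
  orbit of \<open>(mat \<mu> - A) *v x\<close>, a vector killed by one power less when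
  \<open>x\<close> is killed by a power of \<open>mat \<mu> - A\<close>.\<close>

lemma mat_power_recurrence:
  "mat_power A (Suc m) *v x = \<mu> *s (mat_power A m *v x) - mat_power A m *v ((mat \<mu> - A) *v (x :: 'a::field ^ 'n))"
  by (simp add: mat_minus_vec vec.diff vec.scale mat_power_Suc_right del: mat_power.simps(2))

lemma growth_space_less:
  assumes "cmod \<mu> < r" "0 < k"
  shows "mat_power (mat \<mu> - A) j *v x = 0 \<Longrightarrow> x \<in> growth_space A r k"
proof (induction j arbitrary: x)
  case 0
  then show ?case
    by (auto simp: growth_space_def intro!: exI[of _ 0])
next
  case (Suc j)
  then have "(mat \<mu> - A) *v x \<in> growth_space A r k"
    by (simp only: mat_power_Suc_right)
  then obtain C where "\<And>m. norm (mat_power A m *v ((mat \<mu> - A) *v x)) \<le> C * growth_rate r k m"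
    unfolding growth_space_def by blast
  from linear_recurrence_growth_less[OF assms, where u = "\<lambda>m. mat_power A m *v x", OF mat_power_recurrence this]
  show ?case unfolding growth_space_def by blast
qed

text \<open>Each further power of \<open>mat \<mu> - A\<close> is one resonant recurrence and raises
  the order by one, starting from the zero space.\<close>

lemma growth_space_eq:
  assumes "0 < r" "cmod \<mu> = r"
  shows "mat_power (mat \<mu> - A) k *v x = 0 \<Longrightarrow> x \<in> growth_space A r k"
proof (induction k arbitrary: x)
  case 0
  then show ?case by (simp add: growth_space_zero)
next
  case (Suc k)
  then have "(mat \<mu> - A) *v x \<in> growth_space A r k"
    by (simp only: mat_power_Suc_right)
  then obtain C where "\<And>m. norm (mat_power A m *v ((mat \<mu> - A) *v x)) \<le> C * growth_rate r k m"
    unfolding growth_space_def by blast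
  from linear_recurrence_growth_eq[OF assms, where u = "\<lambda>m. mat_power A m *v x", OF mat_power_recurrence this]
  show ?case unfolding growth_space_def by blast
qed

section \<open>Vectors of bounded growth: lower bounds\<close>

lemma polynomial_geometric_tendsto_zero:
  fixes q :: real
  assumes "0 \<le> q" "q < 1"
  shows "(\<lambda>m. real (m + 1) ^ k * q ^ m) \<longlonglongrightarrow> 0"
proof (cases "q = 0")
  case False
  with assms have "0 < q" by simp
  \<comment> \<open>With this \<open>a\<close> the power \<open>q ^ Suc m\<close> is
    \<open>exp (- (a * (m + 1)))\<close>, so the claim reduces to \<open>y^k / exp y\<close> tending
    to zero.\<close>
  define a where "a = - ln q"
  have "0 < a" using assms \<open>0 < q\<close> by (simp add: a_def)
  have exp: "exp (a * real (m + 1)) = inverse (q ^ Suc m)" for m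
  proof -
    have "a * real (m + 1) = - (real (Suc m) * ln q)"
      by (simp add: a_def algebra_simps)
    then show ?thesis
      using exp_of_nat_mult[of "Suc m" "ln q"] \<open>0 < q\<close> by (simp only: exp_minus exp_ln)
  qed
  have "filterlim (\<lambda>m. a * real (m + 1)) at_top sequentially"
    using \<open>0 < a\<close> filterlim_real_sequentially[THEN filterlim_compose, OF filterlim_add_const_nat_at_top[of 1]]
    by (intro filterlim_tendsto_pos_mult_at_top[OF tendsto_const]) auto
  then have "(\<lambda>m. (a * real (m + 1)) ^ k / exp (a * real (m + 1))) \<longlonglongrightarrow> 0"
    by (rule filterlim_compose[OF tendsto_power_div_exp_0])
  then have "(\<lambda>m. inverse (a ^ k * q) * ((a * real (m + 1)) ^ k / exp (a * real (m + 1)))) \<longlonglongrightarrow> inverse (a ^ k * q) * 0"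
    by (rule tendsto_mult_left)
  moreover have "inverse (a ^ k * q) * ((a * real (m + 1)) ^ k / exp (a * real (m + 1))) = real (m + 1) ^ k * q ^ m" for m
    unfolding exp power_mult_distrib using \<open>0 < a\<close> \<open>0 < q\<close> by (simp add: field_simps)
  ultimately show ?thesis by simp
next
  case True
  have "(\<lambda>m. real (Suc m + 1) ^ k * q ^ Suc m) \<longlonglongrightarrow> 0"
    by (simp add: True)
  then show ?thesis
    by (rule LIMSEQ_imp_Suc)
qed

text \<open>By induction \<open>(mat \<mu> - A) *v x\<close> is zero, so \<open>x\<close> satisfies
  the eigenvector equation. Its orbit then grows exactly like \<open>cmod \<mu> ^ m\<close>, too
  fast for the bound unless \<open>x = 0\<close>.\<close>

lemma growth_space_greater:
  assumes "0 \<le> r" "r < cmod \<mu>" "0 < k"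
  shows "mat_power (mat \<mu> - A) j *v x = 0 \<Longrightarrow> x \<in> growth_space A r k \<Longrightarrow> x = 0"
proof (induction j arbitrary: x)
  case (Suc j)
  have "(mat \<mu> - A) *v x = 0"
    using Suc invariant_subspace_mat_minus[OF invariant_subspace_growth_space[OF assms(1)]]
    unfolding mat_power_Suc_right by blast
  then have "A *v x = \<mu> *s x"
    by (simp add: mat_minus_vec)
  then have eig: "mat_power A m *v x = \<mu> ^ m *s x" for m
    by (induction m) (simp_all add: mat_power_Suc_right vec.scale mult.commute del: mat_power.simps(2))
  obtain C where C: "\<And>m. norm (mat_power A m *v x) \<le> C * growth_rate r k m"
    using Suc.prems(2) unfolding growth_space_def by blast
  have "norm x \<le> C * (real (m + 1) ^ (k - 1) * (r / cmod \<mu>) ^ m)" for m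
  proof -
    have "0 < cmod \<mu> ^ m" using assms(1,2) by (intro zero_less_power) linarith
    then show ?thesis
      using C[of m] assms(3)
      by (simp add: eig norm_vector_smult norm_power growth_rate_def power_divide pos_le_divide_eq mult_ac)
  qed
  moreover have "(\<lambda>m. C * (real (m + 1) ^ (k - 1) * (r / cmod \<mu>) ^ m)) \<longlonglongrightarrow> C * 0"
    using assms(1,2) by (intro tendsto_mult_left polynomial_geometric_tendsto_zero) (auto simp: divide_less_eq)
  ultimately have "norm x \<le> C * 0"
    by (intro LIMSEQ_le_const) auto
  then show ?case by simp
qed simp

text \<open>The subtracted vector is the last term of the binomial expansion of the
  \<open>m\<close>-th power of \<open>\<mu> - (\<mu> - A)\<close>. Writing its coefficient with
  \<open>(- 1 / \<mu>) ^ k * \<mu> ^ m\<close> avoids the truncated exponent \<open>m - k\<close>.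
  The remaining terms are estimated together through the recurrence.\<close>

lemma mat_power_leading_term:
  assumes "0 < r" "cmod \<mu> = r"
  shows "mat_power (mat \<mu> - A) (Suc k) *v x = 0 \<Longrightarrow>
    \<exists>C. \<forall>m. norm (mat_power A m *v x -
      (of_nat (m choose k) * (- 1 / \<mu>) ^ k * \<mu> ^ m) *s (mat_power (mat \<mu> - A) k *v x))
      \<le> C * growth_rate r k m"
proof (induction k arbitrary: x)
  case 0
  then have "A *v x = \<mu> *s x"
    by (simp add: mat_minus_vec)
  then have "mat_power A m *v x = \<mu> ^ m *s x" for m
    by (induction m) (simp_all add: mat_power_Suc_right vec.scale mult.commute del: mat_power.simps(2))
  then show ?case by (auto intro: exI[of _ 0])
next
  case (Suc k)
  have "\<mu> \<noteq> 0" using assms by auto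
  define y where "y = (mat \<mu> - A) *v x"
  define e where "e = mat_power (mat \<mu> - A) k *v y"
  have e: "mat_power (mat \<mu> - A) (Suc k) *v x = e"
    unfolding e_def y_def by (rule mat_power_Suc_right)
  define c where "c k m = of_nat (m choose k) * (- 1 / \<mu>) ^ k * \<mu> ^ m" for k m
  have "mat_power (mat \<mu> - A) (Suc k) *v y = 0"
    using Suc.prems unfolding y_def mat_power_Suc_right .
  then obtain C where C: "\<And>m. norm (mat_power A m *v y - c k m *s e) \<le> C * growth_rate r k m"
    using Suc.IH unfolding e_def c_def by blast
  \<comment> \<open>Pascal's rule: the leading coefficients obey the recurrence of the orbit, hence
    so does the error.\<close>
  have c: "c (Suc k) (Suc m) = \<mu> * c (Suc k) m - c k m" for m
    using \<open>\<mu> \<noteq> 0\<close> by (simp add: c_def field_simps)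
  have "mat_power A (Suc m) *v x - c (Suc k) (Suc m) *s e =
      \<mu> *s (mat_power A m *v x - c (Suc k) m *s e) - (mat_power A m *v y - c k m *s e)" for m
    unfolding mat_power_recurrence[of A m x \<mu>] c y_def[symmetric]
    by (simp add: vec.scale_left_diff_distrib vec.scale_right_diff_distrib)
  from linear_recurrence_growth_eq[OF assms this C]
  show ?case unfolding e c_def .
qed

text \<open>The leading term has degree \<open>k\<close> in \<open>m\<close>, while both the error
  and the assumed bound have degree \<open>k - 1\<close>; its vector must therefore vanish.\<close>

lemma growth_space_order_step:
  assumes "0 < r" "cmod \<mu> = r" and ker: "mat_power (mat \<mu> - A) (Suc k) *v x = 0"
    and x: "x \<in> growth_space A r k"
  shows "mat_power (mat \<mu> - A) k *v x = 0"
proof (cases k)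
  case 0
  then show ?thesis using x by (simp add: growth_space_zero)
next
  case (Suc l)
  define e where "e = mat_power (mat \<mu> - A) k *v x"
  define c where "c m = of_nat (m choose k) * (- 1 / \<mu>) ^ k * \<mu> ^ m" for m
  obtain C where C: "\<And>m. norm (mat_power A m *v x - c m *s e) \<le> C * growth_rate r k m"
    using mat_power_leading_term[OF assms(1,2) ker] unfolding e_def c_def by blast
  obtain D where D: "\<And>m. norm (mat_power A m *v x) \<le> D * growth_rate r k m"
    using x unfolding growth_space_def by blast
  \<comment> \<open>The factors come from \<open>(m / k)^k \<le> (m choose k)\<close> and
    \<open>m + 1 \<le> 2 * m\<close>; afterwards \<open>m^l\<close> with \<open>l = k - 1\<close>
    cancels and a single factor \<open>m\<close> is left.\<close>
  define E where "E = (C + D) * r ^ k * 2 ^ l * real k ^ k"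
  have le: "real m * norm e \<le> E" if "k \<le> m" for m
  proof -
    have "0 < m" using that Suc by simp
    have "norm (c m *s e) \<le> (C + D) * growth_rate r k m"
      using norm_triangle_ineq4[of "mat_power A m *v x" "mat_power A m *v x - c m *s e"] C[of m] D[of m]
      by (simp add: algebra_simps)
    moreover have "norm (c m *s e) = real (m choose k) * norm e * (r ^ m / r ^ k)"
      using assms(2) by (simp add: norm_vector_smult c_def norm_mult norm_power norm_divide power_divide)
    moreover have "growth_rate r k m = real (m + 1) ^ l * r ^ k * (r ^ m / r ^ k)"
      using assms(1) by (simp add: growth_rate_def Suc)
    ultimately have "real (m choose k) * norm e * (r ^ m / r ^ k) \<le> (C + D) * r ^ k * real (m + 1) ^ l * (r ^ m / r ^ k)"
      by (simp only: mult_ac)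
    then have *: "real (m choose k) * norm e \<le> (C + D) * r ^ k * real (m + 1) ^ l"
      using assms(1) by (subst (asm) mult_le_cancel_right_pos) auto
    have "0 \<le> (C + D) * r ^ k * real (m + 1) ^ l"
      using * by (rule order_trans[rotated]) simp
    then have "0 \<le> (C + D) * (r ^ k * real (m + 1) ^ l)"
      by (simp only: mult.assoc)
    moreover have "0 < r ^ k * real (m + 1) ^ l"
      using assms(1) by simp
    ultimately have "0 \<le> C + D"
      using mult_neg_pos[of "C + D" "r ^ k * real (m + 1) ^ l"] by linarith
    \<comment> \<open>The estimate of the binomial coefficient from below turns the bound into one
      between powers of \<open>m\<close>.\<close>
    have "real m ^ k * norm e = real k ^ k * ((real m / real k) ^ k * norm e)"
      using Suc by (simp add: power_divide)
    also have "\<dots> \<le> real k ^ k * (real (m choose k) * norm e)"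
      using that by (intro mult_left_mono mult_right_mono binomial_ge_n_over_k_pow_k) auto
    also have "\<dots> \<le> real k ^ k * ((C + D) * r ^ k * real (m + 1) ^ l)"
      using * by (intro mult_left_mono) auto
    also have "\<dots> \<le> real k ^ k * ((C + D) * r ^ k * (2 * real m) ^ l)"
      using \<open>0 \<le> C + D\<close> \<open>0 < m\<close> assms(1) by (intro mult_left_mono power_mono) auto
    also have "\<dots> = E * real m ^ l"
      by (simp add: E_def power_mult_distrib)
    finally show ?thesis
      using \<open>0 < m\<close> by (simp add: Suc mult.assoc mult.left_commute[of _ "real m ^ l"] mult.commute[of _ "real m ^ l"])
  qed
  have "e = 0"
  proof (rule ccontr)
    assume "e \<noteq> 0"
    \<comment> \<open>Beyond \<open>E / norm e\<close> the bound \<open>le\<close> fails; the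
      maximum with \<open>k\<close> puts the index into its range.\<close>
    obtain n :: nat where "E / norm e < real n" using reals_Archimedean2 by blast
    then have "E < real (max k n) * norm e"
      using \<open>e \<noteq> 0\<close> by (simp add: divide_simps) (metis (no_types, lifting) max.cobounded2 mult_right_mono norm_ge_zero of_nat_mono order_less_le_trans of_nat_max)
    then show False using le[of "max k n"] by simp
  qed
  then show ?thesis by (simp add: e_def)
qed

text \<open>Lowers the killing exponent one at a time, applying the previous step to
  \<open>mat_power (mat \<mu> - A) j *v x\<close>, which stays in the growth space.\<close>

lemma growth_space_order:
  assumes "0 < r" "cmod \<mu> = r" and x: "x \<in> growth_space A r k"
  shows "mat_power (mat \<mu> - A) (k + j) *v x = 0 \<Longrightarrow> mat_power (mat \<mu> - A) k *v x = 0"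
proof (induction j)
  case (Suc j)
  let ?y = "mat_power (mat \<mu> - A) j *v x"
  have split: "mat_power (mat \<mu> - A) (l + j) *v x = mat_power (mat \<mu> - A) l *v ?y" for l
    by (simp add: mat_power_add matrix_vector_mul_assoc)
  have "mat_power (mat \<mu> - A) (Suc k) *v ?y = 0"
    using Suc.prems split[of "Suc k"] by simp
  moreover have "?y \<in> growth_space A r k"
    using invariant_subspace_growth_space[of r A k] assms(1) x by (intro invariant_subspace_mat_power) auto
  ultimately have "mat_power (mat \<mu> - A) k *v ?y = 0"
    using growth_space_order_step assms(1,2) by blast
  then show ?case using split[of k] Suc.IH by simp
qed simp

text \<open>Forwards, every part satisfies the bound and the parts sum to \<open>x\<close>.
  Backwards, the parts inherit the bound from \<open>x\<close>; this excludes eigenvalues of modulus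
  above \<open>r\<close> and limits the order at modulus \<open>r\<close>.\<close>

lemma spectral_pair_growth_iff:
  assumes "0 < r" "0 < k"
  shows "spectral_pair A x \<preceq> (r, real k) \<longleftrightarrow> x \<in> growth_space A r k"
proof
  have inv: "invariant_subspace A (growth_space A r k)"
    using assms(1) by (simp add: invariant_subspace_growth_space)
  assume "spectral_pair A x \<preceq> (r, real k)"
  then have "gen_eigen_part A x \<mu> \<in> growth_space A r k" if "gen_eigen_part A x \<mu> \<noteq> 0" for \<mu>
    using that spectral_pair_lex_le_iff[of r k A x] growth_space_eq[of r \<mu> A k] growth_space_less[of \<mu> r k A]
      gen_eigen_part_kernel[of \<mu> A x] assms by (metis less_imp_le)
  then have "(\<Sum>\<mu> | gen_eigen_part A x \<mu> \<noteq> 0. gen_eigen_part A x \<mu>) \<in> growth_space A r k"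
    using inv unfolding invariant_subspace_def by (intro vec.subspace_sum) auto
  then show "x \<in> growth_space A r k"
    by (simp only: gen_eigen_part_sum)
next
  assume x: "x \<in> growth_space A r k"
  have "cmod \<mu> < r \<or> cmod \<mu> = r \<and> mat_power (mat \<mu> - A) k *v gen_eigen_part A x \<mu> = 0"
    if nz: "gen_eigen_part A x \<mu> \<noteq> 0" for \<mu>
  proof -
    have part: "gen_eigen_part A x \<mu> \<in> growth_space A r k"
      using invariant_subspace_growth_space[of r A k] x assms(1)
      by (intro gen_eigen_part_in_invariant_subspace) auto
    obtain j where j: "mat_power (mat \<mu> - A) j *v gen_eigen_part A x \<mu> = 0"
      using gen_eigen_part_kernel by blast
    have "cmod \<mu> \<le> r"
      using growth_space_greater[of r \<mu> k A j] part j nz assms by force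
    moreover have "mat_power (mat \<mu> - A) k *v gen_eigen_part A x \<mu> = 0" if "cmod \<mu> = r"
      using growth_space_order[OF assms(1) that part, of j] mat_power_kernel_mono[OF j, of "k + j"] by simp
    ultimately show ?thesis by fastforce
  qed
  then show "spectral_pair A x \<preceq> (r, real k)"
    using spectral_pair_lex_le_iff[of r k A x] assms by auto
qed

section \<open>The lexicographic ordering\<close>

lemma lex_le_refl [simp]: "p \<preceq> p"
  by (simp add: lex_le_def)

lemma lex_le_trans: "p \<preceq> q \<Longrightarrow> q \<preceq> s \<Longrightarrow> p \<preceq> s"
  by (auto simp: lex_le_def)

lemma lex_le_antisym: "p \<preceq> q \<Longrightarrow> q \<preceq> p \<Longrightarrow> p = q"
  by (auto simp: lex_le_def prod_eq_iff)

lemma lex_le_linear: "p \<preceq> q \<or> q \<preceq> p"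
  by (auto simp: lex_le_def)

subsection \<open>Spectral pairs of real vectors\<close>

text \<open>Names the embedding written out in \<open>sp\<close>. It is isometric and intertwines
  the real and complex powers, so the growth and kernel criteria hold verbatim for real
  vectors.\<close>

definition complexify :: "real ^ 'n \<Rightarrow> complex ^ 'n" where
  "complexify x = (\<chi> i. complex_of_real (x $ i))"

lemma norm_complexify: "norm (complexify x) = norm x"
  by (simp add: norm_vec_def complexify_def)

lemma complexify_eq_0_iff: "complexify x = 0 \<longleftrightarrow> x = 0"
  by (metis norm_complexify norm_eq_zero)

lemma mat_power_complexify:
  "mat_power (map_matrix complex_of_real A) k *v complexify x = complexify (mat_power A k *v x)"
proof (induction k)
  case (Suc k)
  have "map_matrix complex_of_real A *v complexify y = complexify (A *v y)" for y
    by (simp add: vec_eq_iff complexify_def matrix_vector_mult_def)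
  with Suc show ?case
    by (simp add: mat_power_Suc_apply del: mat_power.simps(2))
qed simp

lemma sp_eq_spectral_pair: "sp A x = spectral_pair (map_matrix complex_of_real A) (complexify x)"
  by (simp add: sp_def complexify_def)

lemma sp_lex_le_growth_iff:
  assumes "0 < r" "0 < k"
  shows "sp A x \<preceq> (r, real k) \<longleftrightarrow> (\<exists>C. \<forall>m. norm (mat_power A m *v x) \<le> C * growth_rate r k m)"
  unfolding sp_eq_spectral_pair spectral_pair_growth_iff[OF assms] growth_space_def
  by (simp add: mat_power_complexify norm_complexify)

lemma sp_lex_le_kernel_iff:
  assumes "0 < k"
  shows "sp A x \<preceq> (0, real k) \<longleftrightarrow> mat_power A k *v x = 0"
  unfolding sp_eq_spectral_pair spectral_pair_kernel_iff[OF assms]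
  by (simp add: mat_power_complexify complexify_eq_0_iff)

lemma sp_zero: "sp A 0 = (0, 0)"
  by (simp add: sp_eq_spectral_pair spectral_pair_def complexify_eq_0_iff)

lemma sp_nonzero:
  assumes "x \<noteq> 0"
  obtains r k where "0 \<le> r" "0 < k" "sp A x = (r, real k)"
proof -
  let ?A = "map_matrix complex_of_real A"
  have nz: "complexify x \<noteq> 0" using assms by (simp add: complexify_eq_0_iff)
  then have "0 \<le> local_spectral_radius ?A (complexify x)"
    using local_spectral_radius_attained by (metis norm_ge_zero)
  with nz show ?thesis
    using that local_order_pos[OF nz] by (simp add: sp_eq_spectral_pair spectral_pair_def)
qed

lemma sp_lex_le_zero_iff: "sp A x \<preceq> (0, 0) \<longleftrightarrow> x = 0"
  by (cases "x = 0") (auto simp: sp_zero lex_le_def elim: sp_nonzero[of x A])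

text \<open>With \<open>sp A y\<close> itself as the pair tested against, the kernel criterion
  (radius \<open>0\<close>) or the growth criterion (positive radius) passes from \<open>y\<close>
  to \<open>x\<close>, because \<open>C\<close> does not depend on \<open>m\<close>.\<close>

lemma sp_mono:
  assumes "\<And>m. norm (mat_power A m *v x) \<le> C * norm (mat_power A m *v y)"
  shows "sp A x \<preceq> sp A y"
proof (cases "y = 0")
  case True
  then have "x = 0" using assms[of 0] by simp
  with True show ?thesis by simp
next
  case False
  obtain r k where rk: "0 \<le> r" "0 < k" "sp A y = (r, real k)"
    using sp_nonzero[OF False] by blast
  show ?thesis
  proof (cases "r = 0")
    case True
    then have "mat_power A k *v y = 0"
      using rk sp_lex_le_kernel_iff[of k A y] by simp
    then have "mat_power A k *v x = 0"
      using assms[of k] by simp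
    then show ?thesis
      using True rk sp_lex_le_kernel_iff[of k A x] by simp
  next
    case False
    with rk have "0 < r" by simp
    then obtain D where D: "\<And>m. norm (mat_power A m *v y) \<le> D * growth_rate r k m"
      using sp_lex_le_growth_iff[of r k A y] rk by auto
    have "norm (mat_power A m *v x) \<le> (\<bar>C\<bar> * D) * growth_rate r k m" for m
    proof -
      have "norm (mat_power A m *v x) \<le> \<bar>C\<bar> * norm (mat_power A m *v y)"
        using assms[of m] mult_right_mono[OF abs_ge_self[of C] norm_ge_zero[of "mat_power A m *v y"]] by linarith
      also have "\<dots> \<le> \<bar>C\<bar> * (D * growth_rate r k m)"
        using D by (intro mult_left_mono) auto
      finally show ?thesis by simp
    qed
    then show ?thesis
      using sp_lex_le_growth_iff[OF \<open>0 < r\<close> rk(2)] rk(3) by metis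
  qed
qed

lemma sp_add_lex_le:
  assumes "sp A x \<preceq> sp A z" "sp A y \<preceq> sp A z"
  shows "sp A (x + y) \<preceq> sp A z"
proof (cases "z = 0")
  case True
  with assms show ?thesis
    by (simp add: sp_zero sp_lex_le_zero_iff)
next
  case False
  obtain r k where rk: "0 \<le> r" "0 < k" "sp A z = (r, real k)"
    using sp_nonzero[OF False] by blast
  show ?thesis
  proof (cases "r = 0")
    case True
    then show ?thesis
      using assms rk by (simp add: sp_lex_le_kernel_iff vec.add)
  next
    case False
    with rk have "0 < r" by simp
    then obtain C D where C: "\<And>m. norm (mat_power A m *v x) \<le> C * growth_rate r k m"
      and D: "\<And>m. norm (mat_power A m *v y) \<le> D * growth_rate r k m"
      using assms rk by (auto simp: sp_lex_le_growth_iff)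
    have "norm (mat_power A m *v (x + y)) \<le> (C + D) * growth_rate r k m" for m
      using norm_triangle_mono[OF C D] by (simp add: vec.add algebra_simps)
    then show ?thesis
      using sp_lex_le_growth_iff[OF \<open>0 < r\<close> rk(2)] rk(3) by metis
  qed
qed

lemma sp_scaleR_lex_le: "sp A (c *\<^sub>R x) \<preceq> sp A x"
  by (rule sp_mono[of _ _ "\<bar>c\<bar>"]) (simp add: matrix_vector_mult_scaleR)

text \<open>\<open>B\<close> is bounded and moves past every power of \<open>A\<close>. It is used
  with \<open>B = A\<close> and with powers of \<open>mat 1 + A\<close>.\<close>

lemma sp_commute_lex_le:
  assumes "A ** B = B ** A"
  shows "sp A (B *v x) \<preceq> sp A x"
proof -
  obtain C where "\<And>y. norm (B *v y) \<le> norm y * C"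
    using bounded_linear.bounded[OF matrix_vector_mul_bounded_linear[of B]] by blast
  then show ?thesis
    by (intro sp_mono[of _ _ C]) (simp add: mat_power_commute_vec[OF assms] mult.commute)
qed

subsection \<open>Cones and faces\<close>

text \<open>By pointedness the compact set of unit vectors of \<open>K\<close> misses the closed set
  \<open>- K\<close>, hence has a positive distance \<open>d\<close> from it; scaling to
  \<open>norm x = 1\<close> gives the constant \<open>1 / d\<close>.\<close>

lemma proper_cone_normal:
  assumes "proper_cone K"
  obtains C where "\<And>x y. x \<in> K \<Longrightarrow> y \<in> K \<Longrightarrow> norm x \<le> C * norm (x + y)"
proof -
  have K: "closed K" "convex_cone K" "K \<inter> uminus ` K = {0}"
    using assms by (auto simp: proper_cone_def)
  have "compact (K \<inter> sphere 0 1)"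
    using K(1) by (simp add: closed_Int_compact)
  moreover have "closed (uminus ` K)"
    using K(1) by (rule closed_negations)
  moreover have "(K \<inter> sphere 0 1) \<inter> uminus ` K = {}"
  proof (rule equals0I)
    fix u assume "u \<in> (K \<inter> sphere 0 1) \<inter> uminus ` K"
    then have "u \<in> K \<inter> uminus ` K" "norm u = 1" by auto
    then show False unfolding K(3) by simp
  qed
  ultimately obtain d where "0 < d" and d: "\<And>u w. u \<in> K \<Longrightarrow> norm u = 1 \<Longrightarrow> w \<in> uminus ` K \<Longrightarrow> d \<le> dist u w"
    using separate_compact_closed[of "K \<inter> sphere 0 1" "uminus ` K"] by fastforce
  have "norm x \<le> (1 / d) * norm (x + y)" if "x \<in> K" "y \<in> K" for x y
  proof (cases "x = 0")
    case False
    let ?t = "1 / norm x"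
    have "?t *\<^sub>R x \<in> K" "?t *\<^sub>R y \<in> K"
      using K(2) that by (simp_all add: convex_cone_scaleR)
    then have "d \<le> dist (?t *\<^sub>R x) (- (?t *\<^sub>R y))"
      using False by (intro d) auto
    also have "\<dots> = norm (?t *\<^sub>R (x + y))"
      by (simp add: dist_norm scaleR_add_right)
    also have "\<dots> = norm (x + y) / norm x"
      by simp
    finally show ?thesis
      using False \<open>0 < d\<close> by (simp add: field_simps)
  qed (use \<open>0 < d\<close> in simp)
  then show ?thesis by (rule that)
qed

section \<open>Spectral pairs and the order of the cone\<close>

lemma cone_preserving_mat_power:
  assumes "A \<in> cone_preserving K" "x \<in> K"
  shows "mat_power A m *v x \<in> K"
  using assms by (induction m) (auto simp: cone_preserving_def mat_power_Suc_apply simp del: mat_power.simps(2))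

text \<open>The powers of \<open>A\<close> keep both vectors in \<open>K\<close>, so normality holds
  along the orbits with one constant.\<close>

lemma sp_cone_le_add:
  assumes "proper_cone K" "A \<in> cone_preserving K" "x \<in> K" "y \<in> K"
  shows "sp A x \<preceq> sp A (x + y)"
proof -
  obtain C where C: "\<And>x y. x \<in> K \<Longrightarrow> y \<in> K \<Longrightarrow> norm x \<le> C * norm (x + y)"
    using proper_cone_normal[OF assms(1)] by blast
  show ?thesis
    by (rule sp_mono[of _ _ C]) (simp add: vec.add C cone_preserving_mat_power assms)
qed

lemma sp_add_eq_lex_max:
  assumes "proper_cone K" "A \<in> cone_preserving K" "x \<in> K" "y \<in> K"
  shows "sp A (x + y) = lex_max (sp A x) (sp A y)"
proof (rule lex_le_antisym)
  show "sp A (x + y) \<preceq> lex_max (sp A x) (sp A y)"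
    using lex_le_linear[of "sp A x" "sp A y"] by (auto simp: lex_max_def intro: sp_add_lex_le)
  show "lex_max (sp A x) (sp A y) \<preceq> sp A (x + y)"
    using sp_cone_le_add[OF assms] sp_cone_le_add[OF assms(1,2,4,3)]
    by (simp add: lex_max_def add.commute)
qed

text \<open>Heredity is \<open>sp_cone_le_add\<close> with transitivity. By minimality, these sets
  bound all the hulls below from above.\<close>

lemma sp_sublevel_face:
  assumes "proper_cone K" "A \<in> cone_preserving K"
  shows "cone_face K {z \<in> K. sp A z \<preceq> sp A y}"
    and "(*v) A ` {z \<in> K. sp A z \<preceq> sp A y} \<subseteq> {z \<in> K. sp A z \<preceq> sp A y}"
proof -
  let ?S = "{z \<in> K. sp A z \<preceq> sp A y}"
  have K: "convex_cone K" using assms(1) by (simp add: proper_cone_def)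
  have "sp A 0 \<preceq> sp A y"
    by (rule sp_mono[of _ _ 0]) simp
  then have "0 \<in> ?S" using K by (simp add: convex_cone_contains_0)
  moreover have "u + v \<in> ?S" if "u \<in> ?S" "v \<in> ?S" for u v
    using that K sp_add_lex_le[of A u y v] by (simp add: convex_cone_add)
  moreover have "c *\<^sub>R u \<in> ?S" if "u \<in> ?S" "0 \<le> c" for u c
    using that K sp_scaleR_lex_le lex_le_trans by (blast intro: convex_cone_scaleR)
  ultimately have "convex_cone ?S"
    unfolding convex_cone_iff by blast
  moreover have "u \<in> ?S \<and> v \<in> ?S" if "u \<in> K" "v \<in> K" "u + v \<in> ?S" for u v
    using that sp_cone_le_add[OF assms, of u v] sp_cone_le_add[OF assms, of v u]
    by (auto simp: add.commute intro: lex_le_trans)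
  moreover have "?S \<subseteq> K" by auto
  ultimately show "cone_face K ?S"
    unfolding cone_face_def by (intro conjI ballI impI) simp_all
  show "(*v) A ` ?S \<subseteq> ?S"
  proof clarify
    fix z assume "z \<in> K" "sp A z \<preceq> sp A y"
    then show "A *v z \<in> K \<and> sp A (A *v z) \<preceq> sp A y"
      using assms(2) lex_le_trans[OF sp_commute_lex_le[OF refl]] unfolding cone_preserving_def by blast
  qed
qed

text \<open>\<open>P\<close> is either \<open>cone_face K\<close> or its \<open>A\<close>-invariant
  version. The member \<open>G\<close> makes the intersected family nonempty and so keeps the hull
  inside \<open>K\<close>.\<close>

lemma cone_face_hull:
  assumes P: "\<And>F. P F \<Longrightarrow> cone_face K F" and "P G" "S \<subseteq> G"
  shows "cone_face K (P hull S)"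
proof -
  have "convex_cone (P hull S)"
    unfolding hull_def using P by (intro convex_cone_Inter) (auto simp: cone_face_def)
  moreover have "P hull S \<subseteq> K"
    using P[OF \<open>P G\<close>] hull_minimal[OF \<open>S \<subseteq> G\<close>, of P] \<open>P G\<close> by (auto simp: cone_face_def)
  moreover have "x \<in> P hull S \<and> y \<in> P hull S" if "x \<in> K" "y \<in> K" "x + y \<in> P hull S" for x y
    using that P unfolding hull_def cone_face_def by blast
  ultimately show ?thesis
    unfolding cone_face_def by blast
qed

text \<open>A relative interior point dominates every \<open>y\<close> of the face up to scaling. So
  the pair is constant on the relative interior, as \<open>sp_face\<close> presupposes, and is the
  maximum over the face.\<close>

lemma sp_face_eq:
  assumes "proper_cone K" "A \<in> cone_preserving K" "cone_face K F"
  obtains x where "x \<in> F" "sp_face A F = sp A x" "\<And>y. y \<in> F \<Longrightarrow> sp A y \<preceq> sp A x"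
proof -
  have F: "convex_cone F" "F \<subseteq> K" using assms(3) by (auto simp: cone_face_def)
  then have cF: "convex F" "F \<noteq> {}" by (auto simp: convex_cone_def)
  have le: "sp A y \<preceq> sp A x" if x: "x \<in> rel_interior F" and y: "y \<in> F" for x y
  proof -
    \<comment> \<open>The segment from \<open>y\<close> to \<open>x\<close> is prolonged beyond
      \<open>x\<close> inside \<open>F\<close>; this writes \<open>e *\<^sub>R x\<close> as
      \<open>(e - 1) *\<^sub>R y\<close> plus the new endpoint, a sum in \<open>K\<close>.\<close>
    obtain e where e: "e > 1" "(1 - e) *\<^sub>R y + e *\<^sub>R x \<in> F"
      using x y convex_rel_interior_iff[OF cF] by blast
    let ?z = "(1 - e) *\<^sub>R y + e *\<^sub>R x"
    have "(e - 1) *\<^sub>R y \<in> F"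
      using e(1) y by (intro convex_cone_scaleR[OF F(1)]) auto
    then have "(e - 1) *\<^sub>R y \<in> K" "?z \<in> K"
      using e(2) F(2) by auto
    then have "sp A ((e - 1) *\<^sub>R y) \<preceq> sp A ((e - 1) *\<^sub>R y + ?z)"
      by (rule sp_cone_le_add[OF assms(1,2)])
    also have "(e - 1) *\<^sub>R y + ?z = e *\<^sub>R x"
      by (simp add: algebra_simps)
    finally have "sp A ((e - 1) *\<^sub>R y) \<preceq> sp A x"
      using sp_scaleR_lex_le lex_le_trans by blast
    moreover have "sp A (inverse (e - 1) *\<^sub>R ((e - 1) *\<^sub>R y)) \<preceq> sp A ((e - 1) *\<^sub>R y)"
      by (rule sp_scaleR_lex_le)
    ultimately show ?thesis
      using e(1) lex_le_trans by simp
  qed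
  obtain x where x: "x \<in> rel_interior F"
    using cF rel_interior_eq_empty by blast
  have "sp A ` rel_interior F = {sp A x}"
    using x le lex_le_antisym rel_interior_subset[of F] by blast
  then have "sp_face A F = sp A x"
    unfolding sp_face_def by auto
  then show ?thesis
    using that x le rel_interior_subset[of F] by blast
qed

section \<open>The assertions on faces and on vectors\<close>

lemma sp_face_mono:
  assumes "proper_cone K" "A \<in> cone_preserving K" "cone_face K F" "cone_face K G" "F \<subseteq> G"
  shows "sp_face A F \<preceq> sp_face A G"
  using sp_face_eq[OF assms(1,2,3)] sp_face_eq[OF assms(1,2,4)] assms(5) by (metis subsetD)

lemma sp_face_invariant_face_gen:
  assumes "proper_cone K" "A \<in> cone_preserving K" "cone_face K F"
  shows "sp_face A (invariant_face_gen K A F) = sp_face A F"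
proof (rule lex_le_antisym)
  let ?P = "\<lambda>F. cone_face K F \<and> (*v) A ` F \<subseteq> F"
  have F: "F \<subseteq> K" and K: "?P K"
    using assms by (auto simp: cone_face_def proper_cone_def cone_preserving_def)
  have face: "cone_face K (invariant_face_gen K A F)"
    unfolding invariant_face_gen_def using K F by (intro cone_face_hull[where G = K]) auto
  obtain x where x: "sp_face A F = sp A x" "\<And>y. y \<in> F \<Longrightarrow> sp A y \<preceq> sp A x"
    using sp_face_eq[OF assms] by blast
  obtain z where z: "z \<in> invariant_face_gen K A F" "sp_face A (invariant_face_gen K A F) = sp A z"
    using sp_face_eq[OF assms(1,2) face] by blast
  \<comment> \<open>The sublevel set at a vector attaining the maximum over \<open>F\<close> is an
    invariant face including \<open>F\<close>.\<close>
  have "invariant_face_gen K A F \<subseteq> {z \<in> K. sp A z \<preceq> sp A x}"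
    unfolding invariant_face_gen_def using F x sp_sublevel_face[OF assms(1,2)]
    by (intro hull_minimal) auto
  then show "sp_face A (invariant_face_gen K A F) \<preceq> sp_face A F"
    using z x by auto
  show "sp_face A F \<preceq> sp_face A (invariant_face_gen K A F)"
    using face hull_subset[of F ?P] unfolding invariant_face_gen_def
    by (rule sp_face_mono[OF assms])
qed

lemma sp_face_join:
  assumes "proper_cone K" "A \<in> cone_preserving K" "cone_face K F" "cone_face K G"
  shows "sp_face A (face_join K F G) = lex_max (sp_face A F) (sp_face A G)"
proof (rule lex_le_antisym)
  have FG: "F \<union> G \<subseteq> K" and K: "cone_face K K"
    using assms by (auto simp: cone_face_def proper_cone_def)
  have face: "cone_face K (face_join K F G)"
    unfolding face_join_def face_gen_def using K FG by (intro cone_face_hull[where G = K]) auto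
  obtain x where x: "sp_face A F = sp A x" "\<And>y. y \<in> F \<Longrightarrow> sp A y \<preceq> sp A x"
    using sp_face_eq[OF assms(1,2,3)] by blast
  obtain y where y: "sp_face A G = sp A y" "\<And>z. z \<in> G \<Longrightarrow> sp A z \<preceq> sp A y"
    using sp_face_eq[OF assms(1,2,4)] by blast
  \<comment> \<open>\<open>w\<close> is whichever of \<open>x\<close> and \<open>y\<close> has the
    larger pair, so its sublevel face includes both \<open>F\<close> and \<open>G\<close>.\<close>
  obtain w where w: "lex_max (sp_face A F) (sp_face A G) = sp A w" "sp A x \<preceq> sp A w" "sp A y \<preceq> sp A w"
    using that[of x] that[of y] lex_le_linear[of "sp A x" "sp A y"] x(1) y(1)
    by (cases "sp A x \<preceq> sp A y") (simp_all add: lex_max_def)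
  obtain z where z: "z \<in> face_join K F G" "sp_face A (face_join K F G) = sp A z"
    using sp_face_eq[OF assms(1,2) face] by blast
  have "face_join K F G \<subseteq> {z \<in> K. sp A z \<preceq> sp A w}"
    unfolding face_join_def face_gen_def
    using FG x(2) y(2) w(2,3) lex_le_trans sp_sublevel_face(1)[OF assms(1,2)]
    by (intro hull_minimal) blast+
  then show "sp_face A (face_join K F G) \<preceq> lex_max (sp_face A F) (sp_face A G)"
    using z w by auto
  have "F \<union> G \<subseteq> face_join K F G"
    unfolding face_join_def face_gen_def by (rule hull_subset)
  then have "sp_face A F \<preceq> sp_face A (face_join K F G)" "sp_face A G \<preceq> sp_face A (face_join K F G)"
    using sp_face_mono[OF assms(1,2) _ face] assms(3,4) by blast+
  then show "lex_max (sp_face A F) (sp_face A G) \<preceq> sp_face A (face_join K F G)"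
    by (simp add: lex_max_def)
qed

text \<open>The power commutes with \<open>A\<close>, which bounds the pair from above. From below,
  each factor replaces a vector \<open>y\<close> of \<open>K\<close> by \<open>y + A y\<close>, and
  adding a vector of \<open>K\<close> cannot lower the pair.\<close>

lemma sp_id_add_power:
  assumes "proper_cone K" "A \<in> cone_preserving K" "x \<in> K"
  shows "sp A (mat_power (mat 1 + A) k *v x) = sp A x"
proof (rule lex_le_antisym)
  have K: "convex_cone K" using assms(1) by (simp add: proper_cone_def)
  have "mat_power (mat 1 + A) k ** A = A ** mat_power (mat 1 + A) k"
    by (rule mat_power_commute)
      (simp add: matrix_eq vec.add matrix_vector_mult_add_rdistrib flip: matrix_vector_mul_assoc)
  then show "sp A (mat_power (mat 1 + A) k *v x) \<preceq> sp A x"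
    by (intro sp_commute_lex_le) simp
  have "mat_power (mat 1 + A) k *v x \<in> K \<and> sp A x \<preceq> sp A (mat_power (mat 1 + A) k *v x)"
  proof (induction k)
    case 0
    then show ?case using assms(3) by simp
  next
    case (Suc k)
    let ?y = "mat_power (mat 1 + A) k *v x"
    have eq: "mat_power (mat 1 + A) (Suc k) *v x = ?y + A *v ?y"
      unfolding mat_power_Suc_apply by (simp add: matrix_vector_mult_add_rdistrib)
    have "A *v ?y \<in> K"
      using Suc assms(2) by (auto simp: cone_preserving_def)
    then show ?case
      unfolding eq using Suc K sp_cone_le_add[OF assms(1,2), of ?y "A *v ?y"]
      by (blast intro: convex_cone_add lex_le_trans)
  qed
  then show "sp A x \<preceq> sp A (mat_power (mat 1 + A) k *v x)" ..
qed

lemma sp_face_gen_lex_le: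
  assumes "proper_cone K" "A \<in> cone_preserving K" "y \<in> K" "x \<in> face_gen K {y}"
  shows "sp A x \<preceq> sp A y"
proof -
  have "face_gen K {y} \<subseteq> {z \<in> K. sp A z \<preceq> sp A y}"
    unfolding face_gen_def using assms(3) sp_sublevel_face(1)[OF assms(1,2)]
    by (intro hull_minimal) auto
  then show ?thesis using assms(4) by auto
qed

theorem theorem4p9:
  fixes K :: "(real ^ 'n) set" and A :: "real ^ 'n ^ 'n"
  assumes "proper_cone K" and "A \<in> cone_preserving K"
  shows
    "(\<forall>F G. cone_face K F \<longrightarrow> cone_face K G \<longrightarrow>
        sp_face A F = sp_face A (invariant_face_gen K A F) \<and>
        (F \<subseteq> G \<longrightarrow> sp_face A F \<preceq> sp_face A G) \<and>
        sp_face A (face_join K F G) = lex_max (sp_face A F) (sp_face A G)) \<and>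
     (\<forall>x\<in>K. \<forall>y\<in>K.
        sp A x = sp A (mat_power (mat 1 + A) (CARD('n) - 1) *v x) \<and>
        (x \<in> face_gen K {y} \<longrightarrow> sp A x \<preceq> sp A y) \<and>
        sp A (x + y) = lex_max (sp A x) (sp A y))"
  using sp_face_invariant_face_gen[OF assms] sp_face_mono[OF assms] sp_face_join[OF assms]
    sp_id_add_power[OF assms] sp_face_gen_lex_le[OF assms] sp_add_eq_lex_max[OF assms]
  by (simp del: mat_power.simps)

end
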